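(* Let $p$ be a prime and $n\ge 2$ an integer. Let $$G := \langle x,y : x^{p^n}=y^{p^n}=[x,y]=1\rangle\cong C_{p^n}\times C_{p^n},$$ let $\phi$ be the automorphism of $G$ given by $g^\phi := g^{p^{n-1}+1}$ for all $g\in G$, suppose that $G$ contains a regular partial difference set $D$, and define $$\mathcal{G} := \langle (1,x),(\phi,y)\rangle \le \langle\phi\rangle\ltimes G.$$ Then $\mathcal{G}$ is a nonabelian group isomorphic to $C_{p^n}\rtimes_{p^{n-1}+1}C_{p^n}$ that contains a regular partial difference set with the same parameters as $D$.
   Context: A subset $D$ of a finite group $G$ is a $(v,k,\lambda,\mu)$-partial difference set (PDS) if $|G|=v$, $|D|=k$, every nonidentity $g\in D$ can be expressed as $d_1d_2^{-1}$ with $d_1,d_2\in D$ in exactly $\lambda$ ways, and every $g\in G\setminus(D\cup\{1\})$ can be so expressed in exactly $\mu$ ways. A PDS $D$ is regular if $1\notin D$ and $D=\{d^{-1}:d\in D\}$. $C_{p^n}\rtimes_{p^{n-1}+1}C_{p^n}$ denotes the semidirect product $\langle a,b : a^{p^n}=b^{p^n}=1,\ b^{-1}ab=a^{p^{n-1}+1}\rangle$ of order $p^{2n}$. Automorphisms act on the right; the semidirect product $\langle\phi\rangle\ltimes G$ consists of pairs $(\alpha,g)$ with $\alpha\in\langle\phi\rangle$, $g\in G$ and multiplication $(\alpha,g)(\beta,h)=(\alpha\beta,\,g^\beta h)$.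
   Formalization: The case p = n = 2 is excluded: there φ is inversion, (φ,y) has order 2, and the group generated by (1,x) and (φ,y) is dihedral of order 8, so it is not isomorphic to the semidirect product of order 16 and the claim fails. *)

theory Defs
  imports "HOL-Algebra.Algebra"
begin

section \<open>Groups given by generators and relations\<close>

datatype 'g letter = Pos 'g | Neg 'g

type_synonym 'g word = "'g letter list"

text \<open>
  A relation is a pair of words \<open>(u, v)\<close>, read as the equation \<open>u = v\<close>; a relator \<open>u\<close> is
  the pair \<open>(u, [])\<close>. All elements of the type \<open>'g\<close> are generators. \<open>word_eq R\<close> is the least
  congruence on words that contains \<open>R\<close> and makes \<open>Neg g\<close> inverse to \<open>Pos g\<close>.
\<close>

inductive word_eq :: "('g word \<times> 'g word) set \<Rightarrow> 'g word \<Rightarrow> 'g word \<Rightarrow> bool"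
  for R :: "('g word \<times> 'g word) set"
where
  relation: "(u, v) \<in> R \<Longrightarrow> word_eq R u v"
| cancel_Pos: "word_eq R [Pos g, Neg g] []"
| cancel_Neg: "word_eq R [Neg g, Pos g] []"
| refl: "word_eq R u u"
| sym: "word_eq R u v \<Longrightarrow> word_eq R v u"
| trans: "word_eq R u v \<Longrightarrow> word_eq R v w \<Longrightarrow> word_eq R u w"
| append: "word_eq R u u' \<Longrightarrow> word_eq R v v' \<Longrightarrow> word_eq R (u @ v) (u' @ v')"

definition word_class :: "('g word \<times> 'g word) set \<Rightarrow> 'g word \<Rightarrow> 'g word set"
  where "word_class R u = {v. word_eq R u v}"

definition presented_group :: "('g word \<times> 'g word) set \<Rightarrow> 'g word set monoid"
  where "presented_group R =
    \<lparr>carrier = range (word_class R),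
     monoid.mult = (\<lambda>A B. \<Union>u\<in>A. \<Union>v\<in>B. word_class R (u @ v)),
     one = word_class R []\<rparr>"

section \<open>Partial difference sets\<close>

definition partial_difference_set ::
  "('a, 'b) monoid_scheme \<Rightarrow> nat \<Rightarrow> nat \<Rightarrow> nat \<Rightarrow> nat \<Rightarrow> 'a set \<Rightarrow> bool"
  where "partial_difference_set G v k l m D \<longleftrightarrow>
    group G \<and> finite (carrier G) \<and> D \<subseteq> carrier G \<and> card (carrier G) = v \<and> card D = k \<and>
    (\<forall>g \<in> D - {\<one>\<^bsub>G\<^esub>}. card {(c, d) \<in> D \<times> D. g = c \<otimes>\<^bsub>G\<^esub> inv\<^bsub>G\<^esub> d} = l) \<and>
    (\<forall>g \<in> carrier G - (D \<union> {\<one>\<^bsub>G\<^esub>}). card {(c, d) \<in> D \<times> D. g = c \<otimes>\<^bsub>G\<^esub> inv\<^bsub>G\<^esub> d} = m)"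

definition regular_partial_difference_set ::
  "('a, 'b) monoid_scheme \<Rightarrow> nat \<Rightarrow> nat \<Rightarrow> nat \<Rightarrow> nat \<Rightarrow> 'a set \<Rightarrow> bool"
  where "regular_partial_difference_set G v k l m D \<longleftrightarrow>
    partial_difference_set G v k l m D \<and> \<one>\<^bsub>G\<^esub> \<notin> D \<and> D = m_inv G ` D"

section \<open>The semidirect product of a cyclic group of automorphisms with its group\<close>

text \<open>
  The elements are the pairs \<open>(\<alpha>, g)\<close> with \<open>\<alpha>\<close> in the subgroup generated by \<open>f\<close>. Automorphisms
  act on the right: \<open>g\<^sup>\<beta>\<close> is \<open>\<beta> g\<close>, and \<open>\<alpha>\<beta>\<close> is first \<open>\<alpha>\<close>, then \<open>\<beta>\<close>, which is the product
  of \<open>\<beta>\<close> and \<open>\<alpha>\<close>, in this order, in \<open>AutoGroup\<close>.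
\<close>

definition auto_semidirect ::
  "('a, 'b) monoid_scheme \<Rightarrow> ('a \<Rightarrow> 'a) \<Rightarrow> (('a \<Rightarrow> 'a) \<times> 'a) monoid"
  where "auto_semidirect G f =
    \<lparr>carrier = generate (AutoGroup G) {f} \<times> carrier G,
     monoid.mult = (\<lambda>(\<alpha>, g) (\<beta>, h). (\<beta> \<otimes>\<^bsub>AutoGroup G\<^esub> \<alpha>, \<beta> g \<otimes>\<^bsub>G\<^esub> h)),
     one = (\<one>\<^bsub>AutoGroup G\<^esub>, \<one>\<^bsub>G\<^esub>)\<rparr>"

section \<open>The groups of the theorem\<close>

datatype gen_xy = Gen_x | Gen_y

definition xy_relations :: "nat \<Rightarrow> nat \<Rightarrow> (gen_xy word \<times> gen_xy word) set"
  where "xy_relations p n =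
    {(replicate (p ^ n) (Pos Gen_x), []),
     (replicate (p ^ n) (Pos Gen_y), []),
     ([Neg Gen_x, Neg Gen_y, Pos Gen_x, Pos Gen_y], [])}"

definition G_xy :: "nat \<Rightarrow> nat \<Rightarrow> gen_xy word set monoid"
  where "G_xy p n = presented_group (xy_relations p n)"

definition elt_x :: "nat \<Rightarrow> nat \<Rightarrow> gen_xy word set"
  where "elt_x p n = word_class (xy_relations p n) [Pos Gen_x]"

definition elt_y :: "nat \<Rightarrow> nat \<Rightarrow> gen_xy word set"
  where "elt_y p n = word_class (xy_relations p n) [Pos Gen_y]"

definition phi :: "nat \<Rightarrow> nat \<Rightarrow> gen_xy word set \<Rightarrow> gen_xy word set"
  where "phi p n = (\<lambda>g \<in> carrier (G_xy p n). g [^]\<^bsub>G_xy p n\<^esub> (p ^ (n - 1) + 1))"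

text \<open>
  For \<open>p = n = 2\<close> the map \<open>phi\<close> is inversion, so the square of \<open>(\<phi>, y)\<close> is \<open>(\<phi>\<^sup>2, y\<^sup>-\<^sup>1 y) = (1, 1)\<close> and
  the group below is dihedral of order 8, not of order 16; in all other cases with \<open>p\<close> prime
  and \<open>n \<ge> 2\<close> its order is \<open>p ^ (2 * n)\<close>.
\<close>

definition calG :: "nat \<Rightarrow> nat \<Rightarrow> ((gen_xy word set \<Rightarrow> gen_xy word set) \<times> gen_xy word set) monoid"
  where "calG p n =
    subgroup_generated (auto_semidirect (G_xy p n) (phi p n))
      {(\<one>\<^bsub>AutoGroup (G_xy p n)\<^esub>, elt_x p n), (phi p n, elt_y p n)}"

datatype gen_ab = Gen_a | Gen_b

definition twisted_group :: "nat \<Rightarrow> nat \<Rightarrow> gen_ab word set monoid"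
  where "twisted_group p n = presented_group
    {(replicate (p ^ n) (Pos Gen_a), []),
     (replicate (p ^ n) (Pos Gen_b), []),
     ([Neg Gen_b, Pos Gen_a, Pos Gen_b], replicate (p ^ (n - 1) + 1) (Pos Gen_a))}"

end

theory Submission
  imports Defs "HOL-Number_Theory.Residues"
begin

text \<open>
  Write \<open>r = p ^ (n - 1) + 1\<close>, let \<open>N = p ^ n\<close>, and let \<open>\<G>\<close> be the group generated by
  \<open>(1, x)\<close> and \<open>(\<phi>, y)\<close>. The proof compares \<open>\<G>\<close> with \<open>G\<close> along the second projection
  \<open>(\<alpha>, g) \<mapsto> g\<close>, whose restriction to \<open>\<G>\<close> is a bijection: the element
  \<open>(\<phi>, y)\<^sup>j (1, x)\<^sup>i\<close> has second component \<open>y\<^sup>e x\<^sup>i\<close> with \<open>e = 1 + r + \<dots> + r ^ (j - 1)\<close>,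
  and \<open>j \<mapsto> e\<close> permutes the residues modulo \<open>N\<close> unless \<open>p = n = 2\<close> (\<open>geom_cong_iff\<close>).
  If \<open>d\<close> has first component \<open>\<beta>\<close>, then the second component of \<open>c d\<^sup>-\<^sup>1\<close> in \<open>\<G>\<close> is the image
  under \<open>\<beta>\<^sup>-\<^sup>1\<close> of the quotient in \<open>G\<close> of the second components of \<open>c\<close> and \<open>d\<close>. So the preimage
  of \<open>D\<close> is a partial difference set with the parameters of \<open>D\<close> as soon as \<open>D\<close> is invariant
  under \<open>\<phi>\<close> (\<open>regular_pds_transfer\<close>).

  The invariance, \<open>g\<^sup>r \<in> D\<close> iff \<open>g \<in> D\<close>, is a multiplier theorem (\<open>multiplier\<close>), proved here in
  the integral group ring. Let \<open>(v, k, l, m)\<close> be the parameters and \<open>\<alpha> = l - m\<close>. The element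
  \<open>z = 2 D - \<alpha>\<close> satisfies \<open>z\<^sup>2 = \<Delta> + 4 m G\<close> with \<open>\<Delta> = \<alpha>\<^sup>2 + 4 (k - m)\<close>. Let \<open>q\<close> be an odd prime
  that divides neither \<open>\<Delta>\<close> nor the order of \<open>G\<close>. On the one hand \<open>z ^ q\<close> is
  \<open>\<Delta> ^ ((q - 1) / 2) z\<close> plus a multiple of \<open>G\<close>, and \<open>\<Delta> ^ ((q - 1) / 2)\<close> is \<open>1\<close> or \<open>-1\<close>
  modulo \<open>q\<close>; on the other hand, modulo \<open>q\<close>, the coefficient of \<open>z ^ q\<close> at \<open>h ^ q\<close> is that of
  \<open>z\<close> at \<open>h\<close>. Comparing coefficients, which are small, shows that \<open>h \<mapsto> h ^ q\<close> either preserves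
  \<open>D\<close> or exchanges it with its complement in \<open>G - {1}\<close>. This dichotomy is multiplicative, so it
  holds for all exponents \<open>t\<close> coprime to \<open>2 \<Delta>\<close> and to the order of \<open>G\<close>; and if \<open>\<Delta> \<noteq> 0\<close>, then
  \<open>r\<close> is congruent to such a \<open>t\<close> modulo that order, while \<open>\<Delta> = 0\<close> forces
  \<open>D\<close> to be empty or \<open>G - {1}\<close>. An exchange is impossible: for \<open>p = 2\<close> it
  would make the even number \<open>v\<close> odd, and for odd \<open>p\<close> its \<open>p\<close>-th iterate, again an exchange,
  would be the identity map, because \<open>r ^ p\<close> is \<open>1\<close> modulo \<open>N\<close>.

  Finally, two elements with \<open>a ^ N = b ^ N = 1\<close> and \<open>a b = b a ^ r\<close> generate only the elements
  \<open>b\<^sup>j a\<^sup>i\<close> with \<open>i, j < N\<close> (\<open>generate_twisted_pair\<close>). Hence the presented group has at most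
  \<open>N\<^sup>2\<close> elements, and its homomorphism onto \<open>\<G>\<close>, which has \<open>N\<^sup>2\<close> elements, is an isomorphism.
\<close>

section \<open>Powers in the integral group ring modulo a prime\<close>

lemma funpow_coprime_fixed:
  assumes "(f ^^ q) x = x" "(f ^^ d) x = x" "coprime d (q::nat)" 
  shows "f x = x"
proof (cases "q = 1")
  case False
  obtain u where u: "[d * u = 1] (mod q)"
    using cong_solve_coprime_nat assms(3) by auto
  have "(f ^^ (d * u)) x = x"
    using funpow_mod_eq[where f=f and n=d and x=x and m="d*u"] assms(2) by simp
  moreover have "(f ^^ (d * u)) x = (f ^^ 1) x"
    using funpow_mod_eq[where f=f and n=q and x=x] assms(1) u unfolding cong_def by metis
  ultimately show ?thesis by simp
qed (use assms in simp)

text \<open>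
  An orbit of \<open>f\<close> that is not a fixed point has exactly \<open>q\<close> elements, because \<open>q\<close> is prime; the
  weight \<open>w\<close> is constant on it, so it contributes a multiple of \<open>q\<close> to the sum.
\<close>

lemma sum_cong_sum_fixed_points:
  fixes w :: "'a \<Rightarrow> int"
  assumes "finite S" "f ` S \<subseteq> S" "\<And>x. x \<in> S \<Longrightarrow> (f ^^ q) x = x"
    and "\<And>x. x \<in> S \<Longrightarrow> w (f x) = w x" and q: "Factorial_Ring.prime q"
  shows "[sum w S = sum w {x \<in> S. f x = x}] (mod int q)"
  using assms(1-4)
proof (induction S rule: finite_psubset_induct)
  case (psubset S)
  show ?case
  proof (cases "\<forall>x\<in>S. f x = x")
    case True
    then have "{x \<in> S. f x = x} = S" by auto
    then show ?thesis by simp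
  next
    case False
    then obtain x where x: "x \<in> S" "f x \<noteq> x" by auto
    \<comment> \<open>the orbit of \<open>x\<close>, which is removed from \<open>S\<close> in the induction\<close>
    define Orb where "Orb = (\<lambda>i. (f ^^ i) x) ` {..<q}"
    have it: "(f ^^ i) x \<in> S" for i
      by (induction i) (use x psubset.prems(1) in auto)
    have fq: "(f ^^ (i + q)) x = (f ^^ i) x" for i
      using psubset.prems(2)[OF x(1)] by (simp add: funpow_add)
    have ne: "(f ^^ i) x \<noteq> (f ^^ j) x" if "i < j" "j < q" for i j
    proof
      assume eq: "(f ^^ i) x = (f ^^ j) x"
      have "(f ^^ (j - i)) x = (f ^^ (q - i + j)) x"
        using fq[of "j - i"] that by (simp add: algebra_simps)
      also have "\<dots> = (f ^^ (q - i + i)) x"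
        using eq by (simp add: funpow_add)
      also have "\<dots> = x" using psubset.prems(2)[OF x(1)] that by simp
      finally have "(f ^^ (j - i)) x = x" .
      moreover have "coprime (j - i) q"
      proof -
        have "\<not> q dvd j - i" using that by (auto dest: dvd_imp_le)
        then show ?thesis using q prime_imp_coprime coprime_commute by blast
      qed
      ultimately show False
        using funpow_coprime_fixed[of q f x "j - i"] psubset.prems(2)[OF x(1)] x(2) by auto
    qed
    have inj: "inj_on (\<lambda>i. (f ^^ i) x) {..<q}"
      by (rule linorder_inj_onI) (use ne in auto)
    have Orb: "Orb \<subseteq> S" "x \<in> Orb"
      using it prime_gt_0_nat[OF q] by (auto simp: Orb_def intro!: image_eqI[of x _ 0])
    have nofix: "f z \<noteq> z" if zO: "z \<in> Orb" for z
    proof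
      assume z: "f z = z"
      obtain i where i: "i < q" "z = (f ^^ i) x" using zO by (auto simp: Orb_def)
      have "(f ^^ k) z = z" for k by (induction k) (use z in auto)
      then have "(f ^^ (q - i)) ((f ^^ i) x) = z" using i by simp
      moreover have "(f ^^ (q - i)) ((f ^^ i) x) = (f ^^ (q - i + i)) x"
        by (simp only: funpow_add o_apply)
      ultimately have "x = z"
        using i psubset.prems(2)[OF x(1)] by simp
      with z x show False by simp
    qed
    have wO: "w ((f ^^ i) x) = w x" for i
      by (induction i) (use psubset.prems(3) it in auto)
    have "sum w Orb = of_nat q * w x"
      unfolding Orb_def by (simp add: sum.reindex[OF inj] wO)
    then have 1: "[sum w Orb = 0] (mod int q)" by (simp add: cong_0_iff)
    have "f z \<notin> Orb" if z: "z \<in> S - Orb" for z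
    proof
      assume "f z \<in> Orb"
      then obtain i where i: "f z = (f ^^ i) x" by (auto simp: Orb_def)
      have "q > 0" using prime_gt_0_nat[OF q] .
      have "z = (f ^^ (q - 1)) (f z)"
        using psubset.prems(2)[of z] z \<open>q > 0\<close>
        by (cases q) (simp_all only: funpow_Suc_right, auto)
      also have "\<dots> = (f ^^ ((q - 1 + i) mod q)) x"
        using funpow_mod_eq[where f=f and n=q and x=x] psubset.prems(2)[OF x(1)]
        by (simp add: i funpow_add)
      finally have "z \<in> Orb" using \<open>q > 0\<close> by (auto simp: Orb_def)
      with z show False by simp
    qed
    then have cl: "f ` (S - Orb) \<subseteq> S - Orb" using psubset.prems(1) by auto
    have "[sum w (S - Orb) = sum w {x \<in> S - Orb. f x = x}] (mod int q)"
      by (rule psubset.IH) (use Orb cl psubset.prems in auto)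
    moreover have "{x \<in> S - Orb. f x = x} = {x \<in> S. f x = x}" using nofix by auto
    moreover have "sum w S = sum w Orb + sum w (S - Orb)"
      using Orb psubset.hyps by (simp add: sum.subset_diff add.commute)
    ultimately show ?thesis using cong_add[OF 1] by auto
  qed
qed

text \<open>
  A function \<open>f\<close> on the group stands for the element \<open>\<Sum>a. f a \<cdot> a\<close> of the integral group ring;
  \<open>conv_pow G f m\<close> is the coefficient function of its \<open>m\<close>-th power.
\<close>

fun conv_pow :: "('a, 'b) monoid_scheme \<Rightarrow> ('a \<Rightarrow> int) \<Rightarrow> nat \<Rightarrow> 'a \<Rightarrow> int"
  where
    "conv_pow G f 0 g = of_bool (g = \<one>\<^bsub>G\<^esub>)"
  | "conv_pow G f (Suc m) g =
      (\<Sum>a\<in>carrier G. f a * conv_pow G f m (g \<otimes>\<^bsub>G\<^esub> inv\<^bsub>G\<^esub> a))"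

lemma replicate_of_rotate1: 
  assumes "rotate1 xs = xs" shows "xs = replicate (length xs) (hd xs)"
proof -
  have "zs @ [z] = z # zs \<Longrightarrow> zs = replicate (length zs) z" for zs and z :: 'a
    by (induction zs) auto
  then show ?thesis using assms by (cases xs) auto
qed

lemma prod_list_rotate1: "prod_list (map f (rotate1 xs)) = prod_list (map f xs :: int list)"
  by (cases xs) (auto simp: mult.commute)

context comm_group
begin

abbreviation list_mult :: "'a list \<Rightarrow> 'a"
  where "list_mult xs \<equiv> foldr (\<otimes>) xs \<one>"

lemma list_mult_closed: "set xs \<subseteq> carrier G \<Longrightarrow> list_mult xs \<in> carrier G"
  by (induction xs) auto

lemma list_mult_snoc:
  "set xs \<subseteq> carrier G \<Longrightarrow> a \<in> carrier G \<Longrightarrow> list_mult (xs @ [a]) = a \<otimes> list_mult xs"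
  by (induction xs) (auto simp: list_mult_closed m_lcomm simp del: foldr_append)

lemma list_mult_rotate1: "set xs \<subseteq> carrier G \<Longrightarrow> list_mult (rotate1 xs) = list_mult xs"
  by (cases xs) (auto simp: list_mult_snoc simp del: foldr_append)

lemma list_mult_replicate: "h \<in> carrier G \<Longrightarrow> list_mult (replicate m h) = h [^] m"
  by (induction m) (auto simp: m_comm)

text \<open>
  Multiplying out the power gives a sum over lists of factors, a set on which rotation acts.
\<close>

lemma conv_pow_eq_sum_lists:
  assumes "finite (carrier G)" "g \<in> carrier G"
  shows "conv_pow G f m g =
    (\<Sum>xs | set xs \<subseteq> carrier G \<and> length xs = m \<and> list_mult xs = g. prod_list (map f xs))"
  using assms(2)
proof (induction m arbitrary: g)
  case 0
  then have "{xs. set xs \<subseteq> carrier G \<and> length xs = 0 \<and> list_mult xs = g}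
      = (if g = \<one> then {[]} else {})" by auto
  then show ?case by simp
next
  case (Suc m)
  let ?L = "\<lambda>m g. {xs. set xs \<subseteq> carrier G \<and> length xs = m \<and> list_mult xs = g}"
  have fin: "finite (?L m g)" for g
    by (rule finite_subset[OF _ finite_lists_length_eq[OF assms(1), of m]]) auto
  have eq: "?L (Suc m) g = (\<lambda>(a, xs). a # xs) ` (SIGMA a:carrier G. ?L m (g \<otimes> inv a))"
  proof (intro equalityI subsetI)
    fix xs assume "xs \<in> ?L (Suc m) g"
    then obtain a ys where "xs = a # ys" "a \<in> carrier G" "set ys \<subseteq> carrier G" "length ys = m"
      "a \<otimes> list_mult ys = g" by (auto simp: length_Suc_conv)
    moreover from this have "list_mult ys = g \<otimes> inv a"
      using list_mult_closed[of ys] Suc.prems by (subst inv_solve_right) (simp_all add: m_comm)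
    ultimately show "xs \<in> (\<lambda>(a, xs). a # xs) ` (SIGMA a:carrier G. ?L m (g \<otimes> inv a))"
      by (intro image_eqI[of _ _ "(a, ys)"]) auto
  next
    fix xs assume "xs \<in> (\<lambda>(a, xs). a # xs) ` (SIGMA a:carrier G. ?L m (g \<otimes> inv a))"
    then obtain a ys where "xs = a # ys" "a \<in> carrier G" "set ys \<subseteq> carrier G" "length ys = m"
      "list_mult ys = g \<otimes> inv a" by auto
    then show "xs \<in> ?L (Suc m) g" 
      using Suc.prems m_lcomm[of a g "inv a"] by simp
  qed
  have "conv_pow G f (Suc m) g =
      (\<Sum>a\<in>carrier G. \<Sum>xs\<in>?L m (g \<otimes> inv a). prod_list (map f (a # xs)))"
    using Suc by (simp add: sum_distrib_left)
  also have "\<dots> = (\<Sum>(a, xs)\<in>(SIGMA a:carrier G. ?L m (g \<otimes> inv a)). prod_list (map f (a # xs)))"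
    by (rule sum.Sigma) (use assms fin in auto)
  also have "\<dots> = (\<Sum>xs\<in>?L (Suc m) g. prod_list (map f xs))"
    unfolding eq by (subst sum.reindex) (simp_all add: inj_on_def case_prod_unfold)
  finally show ?case .
qed

text \<open>
  In a commutative group, rotating a list of factors changes neither its product nor the product
  of the coefficients. Since \<open>q\<close> is prime, only the lists fixed by rotation count modulo \<open>q\<close>, and
  these are the constant ones.
\<close>

lemma freshmans_dream_conv_pow:
  assumes fin: "finite (carrier G)" and g: "g \<in> carrier G" and q: "Factorial_Ring.prime q"
  shows "[conv_pow G f q g = (\<Sum>h | h \<in> carrier G \<and> h [^] q = g. f h ^ q)] (mod int q)"
proof -
  let ?S = "{xs. set xs \<subseteq> carrier G \<and> length xs = q \<and> list_mult xs = g}"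
  let ?H = "{h \<in> carrier G. h [^] q = g}"
  have "finite ?S"
    by (rule finite_subset[OF _ finite_lists_length_eq[OF fin, of q]]) auto
  then have 1: "[(\<Sum>xs\<in>?S. prod_list (map f xs)) =
      (\<Sum>xs\<in>{xs \<in> ?S. rotate1 xs = xs}. prod_list (map f xs))] (mod int q)"
    by (rule sum_cong_sum_fixed_points)
      (use q in \<open>auto simp: list_mult_rotate1 prod_list_rotate1 simp flip: rotate_def\<close>)
  have "{xs \<in> ?S. rotate1 xs = xs} = replicate q ` ?H"
  proof (intro equalityI subsetI)
    fix xs assume xs: "xs \<in> {xs \<in> ?S. rotate1 xs = xs}"
    then have "xs = replicate q (hd xs)" using replicate_of_rotate1 by force
    moreover from this xs have "hd xs \<in> carrier G" using prime_gt_0_nat[OF q] by (cases xs) auto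
    ultimately show "xs \<in> replicate q ` ?H"
      using xs list_mult_replicate[of "hd xs" q] by (intro image_eqI[of _ _ "hd xs"]) auto
  qed (use list_mult_replicate prime_gt_0_nat[OF q] in \<open>auto simp: rotate1_replicate\<close>)
  moreover have "inj_on (replicate q) ?H"
    using prime_gt_0_nat[OF q] by (auto simp: inj_on_def)
  ultimately have "(\<Sum>xs\<in>{xs \<in> ?S. rotate1 xs = xs}. prod_list (map f xs)) = (\<Sum>h\<in>?H. f h ^ q)"
    by (simp add: sum.reindex)
  with 1 show ?thesis using conv_pow_eq_sum_lists[OF fin g] by simp
qed

end

section \<open>A multiplier theorem for partial difference sets in abelian groups\<close>

lemma (in monoid) pow_cong_exponent:
  assumes "x \<in> carrier G" "x [^] N = \<one>" "[a = b] (mod N)"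
  shows "x [^] a = x [^] (b::nat)"
proof -
  have "x [^] c = x [^] (c mod N)" for c
  proof -
    have "x [^] c = x [^] (N * (c div N) + c mod N)" by simp
    also have "\<dots> = (x [^] N) [^] (c div N) \<otimes> x [^] (c mod N)"
      using assms(1) by (simp only: nat_pow_mult nat_pow_pow)
    finally show ?thesis using assms by simp
  qed
  then show ?thesis using assms(3) by (metis cong_def)
qed

lemma (in group) pow_coprime_order_inj:
  assumes "coprime t (order G)" "x \<in> carrier G" "y \<in> carrier G" "x [^] t = y [^] t"
  shows "x = (y :: 'a)"
proof -
  obtain u where u: "[t * u = 1] (mod order G)"
    using cong_solve_coprime_nat assms(1) by auto
  have "z = (z [^] t) [^] u" if "z \<in> carrier G" for z
    using pow_cong_exponent[OF that pow_order_eq_1[OF that] u] that by (simp add: nat_pow_pow)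
  then show ?thesis using assms by metis
qed

lemma fermat_int:
  assumes "Factorial_Ring.prime (q::nat)"
  shows "[a ^ q = a] (mod int q)"
proof -
  have q: "q > 0" using assms prime_gt_0_nat by auto
  define b where "b = nat (a mod int q)"
  have ab: "[int b = a] (mod int q)" using q by (simp add: b_def cong_def)
  have "[b ^ q = b] (mod q)"
  proof (cases "q dvd b")
    case True
    then show ?thesis using q dvd_trans[OF True dvd_power[of q b]] by (simp add: cong_def)
  next
    case False
    have "[b * b ^ (q - 1) = b * 1] (mod q)"
      using fermat_theorem[OF assms False] by (rule cong_scalar_left)
    then show ?thesis using q by (simp flip: power_Suc)
  qed
  then have "[int b ^ q = int b] (mod int q)" by (simp flip: of_nat_power add: cong_int_iff)
  then show ?thesis using ab by (meson cong_pow cong_sym cong_trans)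
qed

text \<open>
  The witness is \<open>a + b c\<close>, where \<open>c\<close> is the product of the primes that divide \<open>K\<close> but not \<open>a\<close>:
  every prime divisor of \<open>K\<close> divides exactly one of the two summands.
\<close>

lemma exists_cong_coprime:
  assumes "coprime a (b::nat)" "K > 0"
  shows "\<exists>t. [t = a] (mod b) \<and> coprime t K"
proof -
  let ?Q = "{q \<in> prime_factors K. \<not> q dvd a}"
  let ?t = "a + b * \<Prod>?Q"
  have "\<not> q dvd ?t" if q: "Factorial_Ring.prime q" "q dvd K" for q
  proof (cases "q dvd a")
    case True
    then have "\<not> q dvd b" using assms(1) q(1) by (meson coprime_common_divisor not_prime_unit)
    moreover have "\<not> q dvd \<Prod>?Q"
      using q(1) True primes_dvd_imp_eq[OF q(1)]
      by (auto simp: prime_dvd_prod_iff dest: in_prime_factors_imp_prime)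
    ultimately show ?thesis using q(1) True by (simp add: dvd_add_right_iff prime_dvd_mult_iff)
  next
    case False
    then have "q dvd \<Prod>?Q" using q assms(2) by (intro dvd_prodI) (auto simp: prime_factors_dvd)
    then show ?thesis using False by (simp add: dvd_add_left_iff)
  qed
  then have "coprime ?t K"
    using prime_factor_nat[of "gcd ?t K"] by (auto simp: coprime_iff_gcd_eq_1)
  moreover have "[?t = a] (mod b)" by (simp add: cong_def)
  ultimately show ?thesis by blast
qed

text \<open>
  Substituting \<open>d = e\<^sup>-\<^sup>1\<close> replaces pairs by single elements. In this form the count refers only to
  membership of \<open>g e\<^sup>-\<^sup>1\<close> in \<open>D\<close>, which is what group rings and the passage to another group need.
\<close>

lemma (in group) card_quotients_eq:
  assumes D: "D \<subseteq> carrier G" "D = m_inv G ` D" and g: "g \<in> carrier G"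
  shows "card {(c, d) \<in> D \<times> D. g = c \<otimes> inv d} = card {e \<in> D. g \<otimes> inv e \<in> D}"
proof -
  have inv: "inv e \<in> D" if "e \<in> D" for e using D(2) that by blast
  have "{(c, d) \<in> D \<times> D. g = c \<otimes> inv d} = (\<lambda>e. (g \<otimes> inv e, inv e)) ` {e \<in> D. g \<otimes> inv e \<in> D}"
    (is "?A = ?f ` ?B")
  proof (intro equalityI subsetI)
    fix z assume "z \<in> ?A"
    then obtain c d where "z = (c, d)" "c \<in> D" "d \<in> D" "g = c \<otimes> inv d" by auto
    moreover from this D(1) have "c \<in> carrier G" "d \<in> carrier G" by auto
    ultimately show "z \<in> ?f ` ?B"
      using inv[of d] by (intro image_eqI[of _ _ "inv d"]) (auto simp: m_assoc)
  next
    fix z assume "z \<in> ?f ` ?B"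
    then show "z \<in> ?A" using D(1) g inv by (auto simp: m_assoc subset_iff)
  qed
  moreover have "inj_on ?f ?B" using D(1) by (auto simp: inj_on_def subset_iff)
  ultimately show ?thesis by (simp add: card_image)
qed

locale abelian_regular_pds = comm_group G for G (structure) +
  fixes v k l m :: nat and D :: "'a set"
  assumes pds: "regular_partial_difference_set G v k l m D"
begin

lemma
  shows finite_G: "finite (carrier G)"
    and D_subset: "D \<subseteq> carrier G"
    and card_D: "card D = k"
    and one_notin_D: "\<one> \<notin> D"
    and D_inv: "D = m_inv G ` D"
    and card_fibre_in: "g \<in> D - {\<one>} \<Longrightarrow> card {(c, d) \<in> D \<times> D. g = c \<otimes> inv d} = l"
    and card_fibre_notin: "g \<in> carrier G - (D \<union> {\<one>}) \<Longrightarrow>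
      card {(c, d) \<in> D \<times> D. g = c \<otimes> inv d} = m"
  using pds unfolding regular_partial_difference_set_def partial_difference_set_def by blast+

lemma card_quotient_fibre:
  assumes "g \<in> carrier G"
  shows "card {e \<in> D. g \<otimes> inv e \<in> D} = (if g = \<one> then k else if g \<in> D then l else m)"
proof (cases "g = \<one>")
  case True
  have "inv e \<in> D" if "e \<in> D" for e using D_inv that by blast
  then have "{e \<in> D. \<one> \<otimes> inv e \<in> D} = D" using D_subset by auto
  then show ?thesis using True card_D by simp
next
  case False
  have "card {(c, d) \<in> D \<times> D. g = c \<otimes> inv d} = (if g \<in> D then l else m)"
    using card_fibre_in[of g] card_fibre_notin[of g] False assms by simp
  then show ?thesis using False card_quotients_eq[OF D_subset D_inv assms] by simp
qed

definition alpha :: int where "alpha = int l - int m"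

definition discr :: int where "discr = alpha\<^sup>2 + 4 * (int k - int m)"

text \<open>
  The group ring element \<open>2 D - \<alpha>\<close>, obtained from \<open>D\<close> by completing the square in the quadratic
  equation that \<open>D\<close> satisfies; \<open>discr\<close> is the discriminant of that equation.
\<close>

definition centred :: "'a \<Rightarrow> int"
  where "centred g = 2 * of_bool (g \<in> D) - alpha * of_bool (g = \<one>)"

lemma sum_mult_delta:
  assumes "g \<in> carrier G"
  shows "(\<Sum>a\<in>carrier G. f a * of_bool (g \<otimes> inv a = \<one>)) = (f g :: int)"
proof -
  have "(\<Sum>a\<in>carrier G. f a * of_bool (g \<otimes> inv a = \<one>)) = (\<Sum>a\<in>carrier G. if g = a then f a else 0)"
    using assms by (intro sum.cong[OF HOL.refl]) (auto simp: inv_solve_right')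
  then show ?thesis using assms finite_G by simp
qed

text \<open>
  The parameters say that \<open>D\<^sup>2 = (k - m) + (l - m) D + m G\<close> in the group ring; this is that equation
  after completing the square.
\<close>

lemma centred_square:
  assumes g: "g \<in> carrier G"
  shows "(\<Sum>a\<in>carrier G. centred a * centred (g \<otimes> inv a)) = discr * of_bool (g = \<one>) + 4 * int m"
proof -
  have 1: "(\<Sum>a\<in>carrier G. of_bool (a \<in> D) * of_bool (g \<otimes> inv a \<in> D) :: int) =
      int (if g = \<one> then k else if g \<in> D then l else m)"
  proof -
    have "(\<Sum>a\<in>carrier G. of_bool (a \<in> D) * of_bool (g \<otimes> inv a \<in> D) :: int) =
        (\<Sum>a\<in>carrier G. of_bool (a \<in> {e \<in> D. g \<otimes> inv e \<in> D}))"
      by (intro sum.cong[OF HOL.refl]) auto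
    also have "\<dots> = int (card (carrier G \<inter> {e \<in> D. g \<otimes> inv e \<in> D}))"
      using finite_G by (simp add: Int_def)
    also have "carrier G \<inter> {e \<in> D. g \<otimes> inv e \<in> D} = {e \<in> D. g \<otimes> inv e \<in> D}"
      using D_subset by auto
    finally show ?thesis using card_quotient_fibre[OF g] by simp
  qed
  have 2: "(\<Sum>a\<in>carrier G. of_bool (a = \<one>) * f a) = (f \<one> :: int)" for f
  proof -
    have "(\<Sum>a\<in>carrier G. of_bool (a = \<one>) * f a) = (\<Sum>a\<in>carrier G. if a = \<one> then f a else 0)"
      by (intro sum.cong[OF HOL.refl]) auto
    then show ?thesis using finite_G by simp
  qed
  have "(\<Sum>a\<in>carrier G. centred a * centred (g \<otimes> inv a)) =
      (\<Sum>a\<in>carrier G. 4 * (of_bool (a \<in> D) * of_bool (g \<otimes> inv a \<in> D))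
        - 2 * alpha * (of_bool (a = \<one>) * of_bool (g \<otimes> inv a \<in> D))
        - 2 * alpha * (of_bool (a \<in> D) * of_bool (g \<otimes> inv a = \<one>))
        + alpha\<^sup>2 * (of_bool (a = \<one>) * of_bool (g \<otimes> inv a = \<one>)))"
    by (intro sum.cong[OF HOL.refl]) (simp add: centred_def algebra_simps power2_eq_square)
  also have "\<dots> = 4 * int (if g = \<one> then k else if g \<in> D then l else m)
      - 2 * alpha * of_bool (g \<in> D) - 2 * alpha * of_bool (g \<in> D) + alpha\<^sup>2 * of_bool (g = \<one>)"
    using g by (simp add: sum.distrib sum_subtractf sum_distrib_left[symmetric] 1 2 sum_mult_delta)
  also have "\<dots> = discr * of_bool (g = \<one>) + 4 * int m"
    using one_notin_D by (auto simp: discr_def alpha_def algebra_simps)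
  finally show ?thesis .
qed

text \<open>
  The constant functions, that is, the multiples of \<open>G\<close>, are an ideal of the group ring. Modulo
  this ideal the square of \<open>centred\<close> is \<open>discr\<close>, so two more factors amount to one more \<open>discr\<close>.
\<close>

lemma conv_pow_centred_odd:
  "\<exists>c. \<forall>g\<in>carrier G. conv_pow G centred (2 * n + 1) g = discr ^ n * centred g + c"
proof (induction n)
  case 0
  show ?case by (rule exI[of _ 0]) (auto simp: sum_mult_delta)
next
  case (Suc n)
  then obtain c where c: "\<And>g. g \<in> carrier G \<Longrightarrow> conv_pow G centred (2 * n + 1) g = discr ^ n * centred g + c"
    by blast
  let ?s = "\<Sum>a\<in>carrier G. centred a"
  have 1: "conv_pow G centred (2 * n + 2) g = discr ^ Suc n * of_bool (g = \<one>) + (discr ^ n * 4 * int m + ?s * c)"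
    if g: "g \<in> carrier G" for g
  proof -
    have "conv_pow G centred (2 * n + 2) g =
        (\<Sum>a\<in>carrier G. centred a * conv_pow G centred (2 * n + 1) (g \<otimes> inv a))" by simp
    also have "\<dots> = (\<Sum>a\<in>carrier G. discr ^ n * (centred a * centred (g \<otimes> inv a)) + centred a * c)"
      using g by (intro sum.cong[OF HOL.refl], subst c) (auto simp: algebra_simps)
    also have "\<dots> = discr ^ n * (discr * of_bool (g = \<one>) + 4 * int m) + ?s * c"
      using g by (simp only: sum.distrib centred_square flip: sum_distrib_left sum_distrib_right)
    finally show ?thesis by (simp add: algebra_simps)
  qed
  let ?d = "discr ^ n * 4 * int m + ?s * c"
  have "conv_pow G centred (2 * Suc n + 1) g = discr ^ Suc n * centred g + ?s * ?d"
    if g: "g \<in> carrier G" for g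
  proof -
    have "conv_pow G centred (2 * Suc n + 1) g =
        (\<Sum>a\<in>carrier G. centred a * conv_pow G centred (2 * n + 2) (g \<otimes> inv a))" by simp
    also have "\<dots> = (\<Sum>a\<in>carrier G. discr ^ Suc n * (centred a * of_bool (g \<otimes> inv a = \<one>)) + centred a * ?d)"
      using g by (intro sum.cong[OF HOL.refl], subst 1) (auto simp: algebra_simps)
    also have "\<dots> = discr ^ Suc n * centred g + ?s * ?d"
      using g by (simp only: sum.distrib sum_mult_delta flip: sum_distrib_left sum_distrib_right)
    finally show ?thesis .
  qed
  then show ?case by blast
qed

definition preserves_or_swaps :: "nat \<Rightarrow> bool"
  where "preserves_or_swaps t \<longleftrightarrow>
    (\<forall>h\<in>carrier G - {\<one>}. h [^] t \<in> D \<longleftrightarrow> h \<in> D) \<or> (\<forall>h\<in>carrier G - {\<one>}. h [^] t \<in> D \<longleftrightarrow> h \<notin> D)"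

lemma pow_coprime_neq_one:
  "coprime t (order G) \<Longrightarrow> h \<in> carrier G - {\<one>} \<Longrightarrow> h [^] t \<in> carrier G - {\<one>}"
  using pow_coprime_order_inj[of t h \<one>] by auto

lemma preserves_or_swaps_mult:
  assumes "coprime s (order G)" "preserves_or_swaps s" "preserves_or_swaps t"
  shows "preserves_or_swaps (s * t)"
proof -
  have 1: "h [^] (s * t) = (h [^] s) [^] t" if "h \<in> carrier G - {\<one>}" for h
    using that by (simp add: nat_pow_pow)
  show ?thesis
    using assms(2,3) pow_coprime_neq_one[OF assms(1)] unfolding preserves_or_swaps_def
    by (simp only: 1 cong: ball_cong) meson
qed

text \<open>
  Two evaluations of the \<open>q\<close>-th power of \<open>centred\<close> modulo \<open>q\<close> are compared: the one above, with
  \<open>\<epsilon> = discr ^ ((q - 1) / 2)\<close>, and the one by which its value at \<open>h ^ q\<close> is \<open>centred h\<close>. The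
  unknown constant \<open>c\<close> is determined by the identity, which is not in \<open>D\<close>. If \<open>\<epsilon>\<close> is \<open>1\<close> modulo \<open>q\<close>,
  then \<open>D\<close> is preserved; if \<open>\<epsilon>\<close> is \<open>-1\<close>, then the number of elements of \<open>D\<close> among \<open>h\<close> and
  \<open>h ^ q\<close> does not depend on \<open>h\<close>, and \<open>D\<close> is swapped exactly if this number is one.
\<close>

lemma preserves_or_swaps_prime:
  assumes q: "Factorial_Ring.prime q" "odd q" and cop: "coprime q (order G)"
    and discr: "\<not> int q dvd discr"
  shows "preserves_or_swaps q"
proof -
  obtain n where n: "q = 2 * n + 1" using q(2) oddE by blast
  define \<epsilon> where "\<epsilon> = discr ^ n"
  obtain c where c: "\<And>g. g \<in> carrier G \<Longrightarrow> conv_pow G centred q g = \<epsilon> * centred g + c"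
    using conv_pow_centred_odd[of n] unfolding n \<epsilon>_def by blast
  have pq: "Factorial_Ring.prime (int q)" using q by simp
  have key: "int q dvd centred h - (\<epsilon> * centred (h [^] q) + c)" if h: "h \<in> carrier G" for h
  proof -
    have "{h' \<in> carrier G. h' [^] q = h [^] q} = {h}"
      using pow_coprime_order_inj[OF cop] h by auto
    then have "[conv_pow G centred q (h [^] q) = centred h ^ q] (mod int q)"
      using freshmans_dream_conv_pow[OF finite_G _ q(1), of "h [^] q" centred] h by simp
    then have "[\<epsilon> * centred (h [^] q) + c = centred h] (mod int q)"
      using c[of "h [^] q"] h cong_trans[OF _ fermat_int[OF q(1)]] by auto
    then show ?thesis by (metis cong_iff_dvd_diff cong_sym)
  qed
  have "discr ^ q - discr = discr * ((\<epsilon> - 1) * (\<epsilon> + 1))"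
    by (simp add: n \<epsilon>_def algebra_simps flip: power_add mult_2)
  then have "int q dvd discr * ((\<epsilon> - 1) * (\<epsilon> + 1))"
    using fermat_int[OF q(1), of discr] by (simp add: cong_iff_dvd_diff)
  then have "int q dvd (\<epsilon> - 1) * (\<epsilon> + 1)"
    using discr pq prime_dvd_mult_iff by blast
  then have eps: "int q dvd \<epsilon> - 1 \<or> int q dvd \<epsilon> + 1" using pq by (simp add: prime_dvd_mult_iff)
  \<comment> \<open>\<open>centred\<close> has the value \<open>-alpha\<close> at the identity\<close>
  have at_one: "int q dvd (\<epsilon> - 1) * alpha - c"
    using key[of \<one>] one_notin_D by (simp add: centred_def algebra_simps)
  let ?i = "\<lambda>h. of_bool (h \<in> D) :: int"
  have at_other: "int q dvd 2 * ?i h - (\<epsilon> * (2 * ?i (h [^] q)) + c)" if "h \<in> carrier G - {\<one>}" for h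
    using key[of h] that pow_coprime_neq_one[OF cop that] by (simp add: centred_def)
  \<comment> \<open>congruences modulo \<open>q \<ge> 3\<close> between numbers \<open>0\<close>, \<open>1\<close>, \<open>2\<close> are equalities\<close>
  have small: "x = 0" if "int q dvd 2 * x" "\<bar>x\<bar> < 3" for x
  proof -
    have "2 < q" using q prime_ge_2_nat[of q] by (cases "q = 2") auto
    then have "\<not> int q dvd 2" by (auto dest: zdvd_imp_le)
    then have "int q dvd x" using that(1) pq by (simp add: prime_dvd_mult_iff)
    then show ?thesis using that(2) \<open>2 < q\<close> dvd_imp_le_int[of x "int q"] by linarith
  qed
  from eps show ?thesis
  proof
    assume e: "int q dvd \<epsilon> - 1"
    have "h [^] q \<in> D \<longleftrightarrow> h \<in> D" if h: "h \<in> carrier G - {\<one>}" for h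
    proof -
      have "int q dvd (2 * ?i h - (\<epsilon> * (2 * ?i (h [^] q)) + c)) - ((\<epsilon> - 1) * alpha - c)
          + (\<epsilon> - 1) * (alpha + 2 * ?i (h [^] q))"
        by (rule dvd_add[OF dvd_diff[OF at_other[OF h] at_one] dvd_mult2[OF e]])
      also have "\<dots> = 2 * (?i h - ?i (h [^] q))" by (simp add: algebra_simps)
      finally have "?i h - ?i (h [^] q) = 0" by (rule small) auto
      then show ?thesis by auto
    qed
    then show ?thesis unfolding preserves_or_swaps_def by blast
  next
    assume e: "int q dvd \<epsilon> + 1"
    let ?s = "\<lambda>h. ?i h + ?i (h [^] q)"
    have const: "?s h = ?s h'" if h: "h \<in> carrier G - {\<one>}" "h' \<in> carrier G - {\<one>}" for h h'
    proof -
      have "int q dvd (2 * ?i h - (\<epsilon> * (2 * ?i (h [^] q)) + c))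
          - (2 * ?i h' - (\<epsilon> * (2 * ?i (h' [^] q)) + c))
          + (\<epsilon> + 1) * (2 * ?i (h [^] q) - 2 * ?i (h' [^] q))"
        by (rule dvd_add[OF dvd_diff[OF at_other[OF h(1)] at_other[OF h(2)]] dvd_mult2[OF e]])
      also have "\<dots> = 2 * (?s h - ?s h')" by (simp add: algebra_simps)
      finally have "?s h - ?s h' = 0" by (rule small) auto
      then show ?thesis by simp
    qed
    show ?thesis
    proof (cases "\<exists>h\<in>carrier G - {\<one>}. ?s h = 1")
      case True
      then have "?s h = 1" if "h \<in> carrier G - {\<one>}" for h using const that by metis
      then have "h [^] q \<in> D \<longleftrightarrow> h \<notin> D" if "h \<in> carrier G - {\<one>}" for h
        using that by (force split: if_splits simp: of_bool_def)
      then show ?thesis unfolding preserves_or_swaps_def by blast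
    next
      case False
      then have "h [^] q \<in> D \<longleftrightarrow> h \<in> D" if "h \<in> carrier G - {\<one>}" for h
        using that by (force split: if_splits simp: of_bool_def)
      then show ?thesis unfolding preserves_or_swaps_def by blast
    qed
  qed
qed

lemma preserves_or_swaps_coprime:
  assumes "coprime t (order G)" "coprime t (2 * nat \<bar>discr\<bar>)"
  shows "preserves_or_swaps t"
  using assms
proof (induction t rule: prime_divisors_induct)
  case zero
  then show ?case by (auto dest: coprime_imp_gcd_eq_1)
next
  case (unit t)
  then show ?case by (auto simp: preserves_or_swaps_def)
next
  case (factor q t)
  have "odd q" using factor.prems(2) by auto
  moreover have "\<not> int q dvd discr"
  proof
    assume "int q dvd discr"
    then have "q dvd nat \<bar>discr\<bar>" by (simp add: nat_abs_dvd_iff)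
    then have "q dvd 2 * nat \<bar>discr\<bar>" by simp
    then show False using factor.prems(2) factor.hyps(1)
      by (meson coprime_common_divisor coprime_mult_left_iff dvd_refl not_prime_unit)
  qed
  ultimately have "preserves_or_swaps q"
    using preserves_or_swaps_prime factor by simp
  then show ?case using factor preserves_or_swaps_mult[of q t] by simp
qed

text \<open>
  A nontrivial \<open>D\<close> has \<open>m \<le> k\<close>, so \<open>discr\<close> vanishes only if \<open>l = m = k\<close>. Then for \<open>a \<in> D\<close> all
  \<open>e \<in> D\<close>, in particular \<open>e = a\<close>, have \<open>a e\<^sup>-\<^sup>1 \<in> D\<close>, which puts the identity into \<open>D\<close>.
\<close>

lemma discr_eq_0_imp_trivial:
  assumes "discr = 0"
  shows "D = {} \<or> D = carrier G - {\<one>}"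
proof (rule ccontr)
  assume neg: "\<not> ?thesis"
  obtain a where a: "a \<in> D" using neg by blast
  obtain b where b: "b \<in> carrier G - {\<one>}" "b \<notin> D" using neg D_subset one_notin_D by blast
  have finD: "finite D" using D_subset finite_G finite_subset by blast
  have "m \<le> k"
    using card_quotient_fibre[of b] b card_mono[OF finD, of "{e \<in> D. b \<otimes> inv e \<in> D}"] card_D by auto
  then have "alpha\<^sup>2 = 0" "k = m"
    using assms unfolding discr_def by (smt (verit) of_nat_mono zero_le_power2 of_nat_eq_iff)+
  then have "l = k" by (simp add: alpha_def)
  moreover have "a \<noteq> \<one>" "a \<in> carrier G" using a one_notin_D D_subset by auto
  ultimately have "card {e \<in> D. a \<otimes> inv e \<in> D} = card D"
    using card_quotient_fibre[of a] a card_D by simp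
  then have "{e \<in> D. a \<otimes> inv e \<in> D} = D" using finD by (intro card_subset_eq) auto
  then have "a \<otimes> inv a \<in> D" using a by blast
  then show False using one_notin_D \<open>a \<in> carrier G\<close> by simp
qed

text \<open>
  The exponent may be changed modulo the order of the group, so it may be taken coprime to
  \<open>2 discr\<close>. The assumption \<open>ord\<close> serves to exclude that \<open>D\<close> is swapped with its complement:
  this complement would have as many elements as \<open>D\<close>, so the group would have odd order; and
  iterating the swap an odd number of times is again a swap, hence not the identity map.
\<close>

theorem multiplier:
  assumes r: "coprime r (order G)"
    and ord: "even (order G) \<or> (\<exists>j. odd j \<and> (\<forall>g\<in>carrier G. g [^] (r ^ j) = g))"
    and g: "g \<in> carrier G"
  shows "g [^] r \<in> D \<longleftrightarrow> g \<in> D"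
proof (cases "g = \<one> \<or> discr = 0")
  case True
  then show ?thesis
    using discr_eq_0_imp_trivial pow_coprime_neq_one[OF r, of g] g by (cases "g = \<one>") auto
next
  case False
  then have "2 * nat \<bar>discr\<bar> > 0" by simp
  then obtain t where t: "[t = r] (mod order G)" "coprime t (2 * nat \<bar>discr\<bar>)"
    using exists_cong_coprime[OF r] by blast
  have cop: "coprime t (order G)" using t(1) r by (metis cong_imp_coprime cong_sym)
  have pow: "h [^] t = h [^] r" if "h \<in> carrier G" for h
    using pow_cong_exponent[OF that pow_order_eq_1[OF that] t(1)] .
  have ne: "h [^] t \<in> carrier G - {\<one>}" if "h \<in> carrier G - {\<one>}" for h
    using pow_coprime_neq_one[OF cop that] .
  have "\<not> (\<forall>h\<in>carrier G - {\<one>}. h [^] t \<in> D \<longleftrightarrow> h \<notin> D)"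
  proof
    assume swap: "\<forall>h\<in>carrier G - {\<one>}. h [^] t \<in> D \<longleftrightarrow> h \<notin> D"
    from ord show False
    proof
      assume "even (order G)"
      let ?C = "carrier G - {\<one>} - D"
      have fin: "finite D" "finite ?C" using D_subset finite_G finite_subset by blast+
      have inj: "inj_on (\<lambda>h. h [^] t) A" if "A \<subseteq> carrier G" for A
        using pow_coprime_order_inj[OF cop] that by (meson inj_onI subsetD)
      have Dc: "h \<in> carrier G - {\<one>}" if "h \<in> D" for h
        using that D_subset one_notin_D by blast
      have "h [^] t \<in> ?C" if "h \<in> D" for h
        using swap[rule_format, OF Dc[OF that]] ne[OF Dc[OF that]] that by blast
      then have "card D \<le> card ?C"
        by (intro card_inj_on_le[OF inj[OF D_subset] _ fin(2)]) auto
      moreover have "h [^] t \<in> D" if "h \<in> ?C" for h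
        using swap[rule_format, of h] that by blast
      then have "card ?C \<le> card D"
        by (intro card_inj_on_le[OF inj[of ?C] _ fin(1)]) auto
      ultimately have "card D = card ?C" by simp
      moreover have "order G = card D + card ?C + 1"
      proof -
        have "carrier G = insert \<one> (D \<union> ?C)" using D_subset by auto
        then have "order G = card (insert \<one> (D \<union> ?C))" unfolding order_def by simp
        also have "\<dots> = card D + card ?C + 1"
          using fin one_notin_D card_Un_disjoint[OF fin Diff_disjoint] by (simp del: Un_Diff_cancel)
        finally show ?thesis .
      qed
      ultimately show False using \<open>even (order G)\<close> by simp
    next
      assume "\<exists>j. odd j \<and> (\<forall>g\<in>carrier G. g [^] (r ^ j) = g)"
      then obtain j where j: "odd j" "g [^] (r ^ j) = g" using g by blast
      have "g [^] (t ^ i) \<in> carrier G - {\<one>} \<and> (g [^] (t ^ i) \<in> D \<longleftrightarrow> (g \<in> D \<longleftrightarrow> even i))" for i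
      proof (induction i)
        case 0
        then show ?case using g False by simp
      next
        case (Suc i)
        have "g [^] (t ^ Suc i) = (g [^] (t ^ i)) [^] t"
          using g by (simp add: nat_pow_pow mult.commute)
        then show ?case using Suc swap ne[of "g [^] (t ^ i)"] by auto
      qed
      moreover have "g [^] (t ^ j) = g"
        using pow_cong_exponent[OF g pow_order_eq_1[OF g], of "t ^ j" "r ^ j"] t(1) j(2)
        by (simp add: cong_pow)
      ultimately show False using j(1) by metis
    qed
  qed
  then have "\<forall>h\<in>carrier G - {\<one>}. h [^] t \<in> D \<longleftrightarrow> h \<in> D"
    using preserves_or_swaps_coprime[OF cop t(2)] unfolding preserves_or_swaps_def by blast
  then show ?thesis using g False pow by auto
qed

end

section \<open>Groups given by generators and relations\<close>

lemma word_class_eq_iff: "word_class R u = word_class R v \<longleftrightarrow> word_eq R u v"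
proof
  assume "word_class R u = word_class R v"
  then have "v \<in> word_class R u" by (simp add: word_class_def word_eq.refl)
  then show "word_eq R u v" by (simp add: word_class_def)
next
  assume uv: "word_eq R u v"
  have "word_eq R u w \<longleftrightarrow> word_eq R v w" for w
    using word_eq.trans[OF uv] word_eq.trans[OF word_eq.sym[OF uv]] by blast
  then show "word_class R u = word_class R v" by (simp add: word_class_def)
qed

lemma mult_word_class:
  "word_class R u \<otimes>\<^bsub>presented_group R\<^esub> word_class R v = word_class R (u @ v)"
proof -
  have cong: "word_class R (u' @ v') = word_class R (u @ v)" if "u' \<in> word_class R u" "v' \<in> word_class R v" for u' v'
    unfolding word_class_eq_iff using that by (simp add: word_class_def word_eq.append word_eq.sym)
  have "(\<Union>u'\<in>word_class R u. \<Union>v'\<in>word_class R v. word_class R (u' @ v')) =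
      (\<Union>u'\<in>word_class R u. \<Union>v'\<in>word_class R v. word_class R (u @ v))"
    using cong by (intro SUP_cong HOL.refl)
  moreover have "u \<in> word_class R u" "v \<in> word_class R v"
    by (simp_all add: word_class_def word_eq.refl)
  ultimately show ?thesis by (auto simp: presented_group_def)
qed

lemma one_presented_group: "\<one>\<^bsub>presented_group R\<^esub> = word_class R []"
  by (simp add: presented_group_def)

lemma carrier_presented_group: "carrier (presented_group R) = range (word_class R)"
  by (simp add: presented_group_def)

fun inv_letter :: "'g letter \<Rightarrow> 'g letter"
  where "inv_letter (Pos g) = Neg g" | "inv_letter (Neg g) = Pos g"

lemma word_eq_inverse: "word_eq R (rev (map inv_letter w) @ w) []"
proof (induction w)
  case Nil
  show ?case by (simp add: word_eq.refl)
next
  case (Cons a w)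
  have "word_eq R [inv_letter a, a] []"
    by (cases a) (simp_all add: word_eq.cancel_Pos word_eq.cancel_Neg)
  then have "word_eq R (rev (map inv_letter w) @ ([inv_letter a, a] @ w)) (rev (map inv_letter w) @ ([] @ w))"
    by (intro word_eq.append word_eq.refl)
  with Cons show ?case using word_eq.trans by auto
qed

lemma group_presented_group: "group (presented_group R)"
proof (rule groupI)
  fix A assume "A \<in> carrier (presented_group R)"
  then obtain w where "A = word_class R w" by (auto simp: carrier_presented_group)
  then have "word_class R (rev (map inv_letter w)) \<otimes>\<^bsub>presented_group R\<^esub> A = \<one>\<^bsub>presented_group R\<^esub>"
    using word_eq_inverse by (simp add: mult_word_class one_presented_group word_class_eq_iff)
  then show "\<exists>B\<in>carrier (presented_group R). B \<otimes>\<^bsub>presented_group R\<^esub> A = \<one>\<^bsub>presented_group R\<^esub>"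
    by (auto simp: carrier_presented_group)
qed (auto simp: carrier_presented_group mult_word_class one_presented_group)

fun letter_value :: "('a, 'b) monoid_scheme \<Rightarrow> ('g \<Rightarrow> 'a) \<Rightarrow> 'g letter \<Rightarrow> 'a"
  where
    "letter_value H h (Pos g) = h g"
  | "letter_value H h (Neg g) = inv\<^bsub>H\<^esub> h g"

definition word_value :: "('a, 'b) monoid_scheme \<Rightarrow> ('g \<Rightarrow> 'a) \<Rightarrow> 'g word \<Rightarrow> 'a"
  where "word_value H h w = foldr (\<lambda>a. (\<otimes>\<^bsub>H\<^esub>) (letter_value H h a)) w \<one>\<^bsub>H\<^esub>"

lemma word_value_simps [simp]:
  "word_value H h [] = \<one>\<^bsub>H\<^esub>"
  "word_value H h (a # w) = letter_value H h a \<otimes>\<^bsub>H\<^esub> word_value H h w"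
  by (simp_all add: word_value_def)

context group
begin

lemma letter_value_closed: "range h \<subseteq> carrier G \<Longrightarrow> letter_value G h a \<in> carrier G"
  by (cases a) auto

lemma word_value_closed: "range h \<subseteq> carrier G \<Longrightarrow> word_value G h w \<in> carrier G"
  by (induction w) (auto simp: letter_value_closed)

lemma word_value_append:
  "range h \<subseteq> carrier G \<Longrightarrow> word_value G h (u @ v) = word_value G h u \<otimes> word_value G h v"
  by (induction u) (auto simp: letter_value_closed word_value_closed m_assoc)

lemma word_value_replicate:
  assumes "range h \<subseteq> carrier G"
  shows "word_value G h (replicate m (Pos g)) = h g [^] m"
proof (induction m)
  case (Suc m)
  have "h g \<in> carrier G" using assms by blast
  then show ?case using Suc nat_pow_Suc2[of "h g" m] by simp
qed simp

lemma range_word_value: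
  assumes "range h \<subseteq> carrier G"
  shows "range (word_value G h) = generate G (range h)"
proof (intro equalityI subsetI)
  fix z assume "z \<in> range (word_value G h)"
  then obtain w where "z = word_value G h w" by blast
  moreover have "letter_value G h a \<in> generate G (range h)" for a
    by (cases a) (auto intro: generate.incl generate.inv)
  then have "word_value G h w \<in> generate G (range h)" for w
    by (induction w) (auto intro: generate.one generate.eng)
  ultimately show "z \<in> generate G (range h)" by simp
next
  fix z assume "z \<in> generate G (range h)"
  then show "z \<in> range (word_value G h)"
  proof induction
    case one
    show ?case by (rule range_eqI[of _ _ "[]"]) simp
  next
    case (incl z)
    then obtain g where "z = h g" by blast
    moreover from this assms have "h g \<in> carrier G" by blast
    ultimately show ?case by (intro range_eqI[of _ _ "[Pos g]"]) simp
  next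
    case (inv z)
    then obtain g where "z = h g" by blast
    moreover from this assms have "h g \<in> carrier G" by blast
    ultimately show ?case by (intro range_eqI[of _ _ "[Neg g]"]) simp
  next
    case (eng y z)
    then obtain u v where "y = word_value G h u" "z = word_value G h v" by blast
    then show ?case by (intro range_eqI[of _ _ "u @ v"]) (simp add: word_value_append[OF assms])
  qed
qed

lemma word_value_cong:
  assumes h: "range h \<subseteq> carrier G"
    and R: "\<And>u v. (u, v) \<in> R \<Longrightarrow> word_value G h u = word_value G h v"
    and "word_eq R u v"
  shows "word_value G h u = word_value G h v"
  using assms(3)
proof induction
  case (relation u v)
  then show ?case by (rule R)
next
  case (cancel_Pos g)
  have "h g \<in> carrier G" using h by blast
  then show ?case by simp
next
  case (cancel_Neg g)
  have "h g \<in> carrier G" using h by blast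
  then show ?case by simp
qed (simp_all add: word_value_append[OF h])

text \<open>
  Von Dyck's theorem: an assignment of the generators that respects the relations extends to a
  homomorphism.
\<close>

lemma presented_group_universal:
  assumes h: "range h \<subseteq> carrier G"
    and R: "\<And>u v. (u, v) \<in> R \<Longrightarrow> word_value G h u = word_value G h v"
  shows "\<exists>\<psi>\<in>hom (presented_group R) G. (\<forall>w. \<psi> (word_class R w) = word_value G h w) \<and>
    \<psi> ` carrier (presented_group R) = generate G (range h)"
proof -
  define \<psi> where "\<psi> A = word_value G h (SOME w. w \<in> A)" for A
  have val: "\<psi> (word_class R w) = word_value G h w" for w
  proof -
    have "w \<in> word_class R w" by (simp add: word_class_def word_eq.refl)
    then have "(SOME u. u \<in> word_class R w) \<in> word_class R w" by (rule someI)
    then have "word_eq R w (SOME u. u \<in> word_class R w)" by (simp add: word_class_def)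
    then show ?thesis unfolding \<psi>_def using word_value_cong[OF h R] by metis
  qed
  moreover have "\<psi> \<in> hom (presented_group R) G"
    by (rule homI)
      (auto simp: carrier_presented_group mult_word_class val word_value_append[OF h] word_value_closed[OF h])
  moreover have "\<psi> ` carrier (presented_group R) = generate G (range h)"
    by (simp add: carrier_presented_group image_image val flip: range_word_value[OF h])
  ultimately show ?thesis by blast
qed

end

lemma inv_word_class: "inv\<^bsub>presented_group R\<^esub> word_class R [Pos g] = word_class R [Neg g]"
  by (rule group.inv_equality[OF group_presented_group])
    (auto simp: carrier_presented_group mult_word_class one_presented_group word_class_eq_iff
      word_eq.cancel_Neg)

lemma word_class_eq_word_value:
  "word_class R w = word_value (presented_group R) (\<lambda>g. word_class R [Pos g]) w"
proof (induction w)
  case (Cons a w)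
  have "letter_value (presented_group R) (\<lambda>g. word_class R [Pos g]) a = word_class R [a]"
    by (cases a) (simp_all add: inv_word_class)
  then show ?case using Cons by (simp add: mult_word_class flip: Cons)
qed (simp add: one_presented_group)

lemma presented_group_generated:
  "carrier (presented_group R) = generate (presented_group R) (range (\<lambda>g. word_class R [Pos g]))"
proof -
  have "word_class R = word_value (presented_group R) (\<lambda>g. word_class R [Pos g])"
    using word_class_eq_word_value by blast
  moreover have "range (\<lambda>g. word_class R [Pos g]) \<subseteq> carrier (presented_group R)"
    by (auto simp: carrier_presented_group)
  ultimately show ?thesis
    using group.range_word_value[OF group_presented_group] by (metis carrier_presented_group)
qed

lemma presented_group_relation:
  assumes "(u, v) \<in> R"
  shows "word_value (presented_group R) (\<lambda>g. word_class R [Pos g]) u =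
    word_value (presented_group R) (\<lambda>g. word_class R [Pos g]) v"
  using assms by (simp add: word_class_eq_iff word_eq.relation flip: word_class_eq_word_value)

section \<open>Groups generated by a pair with a twisted commutation rule\<close>

context group
begin

lemma pow_commute_twist:
  assumes "a \<in> carrier G" "b \<in> carrier G" "a \<otimes> b = b \<otimes> a [^] r"
  shows "a [^] i \<otimes> b [^] j = b [^] j \<otimes> a [^] (i * r ^ j :: nat)"
proof -
  have 1: "a [^] i \<otimes> b = b \<otimes> a [^] (i * r)" for i
  proof (induction i)
    case (Suc i)
    have "a [^] Suc i \<otimes> b = a [^] i \<otimes> (b \<otimes> a [^] r)" using assms by (simp add: m_assoc)
    also have "\<dots> = b \<otimes> (a [^] (i * r) \<otimes> a [^] r)" using assms Suc by (simp flip: m_assoc)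
    finally show ?case using assms by (simp add: nat_pow_mult add.commute)
  qed (use assms in simp)
  show ?thesis
  proof (induction j arbitrary: i)
    case (Suc j)
    have "a [^] i \<otimes> b [^] Suc j = b [^] j \<otimes> (a [^] (i * r ^ j) \<otimes> b)"
      using assms Suc by (simp flip: m_assoc)
    also have "\<dots> = b [^] Suc j \<otimes> a [^] (i * r ^ Suc j)"
      using assms by (simp add: 1 m_assoc mult_ac)
    finally show ?case .
  qed (use assms in simp)
qed

text \<open>
  The commutation rule moves all powers of \<open>a\<close> to the right, so the elements \<open>b\<^sup>j a\<^sup>i\<close> are closed
  under multiplication.
\<close>

lemma generate_twisted_pair:
  assumes a: "a \<in> carrier G" and b: "b \<in> carrier G" and ab: "a \<otimes> b = b \<otimes> a [^] (r::nat)"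
    and N: "a [^] N = \<one>" "b [^] N = \<one>" "N > (0::nat)"
  shows "generate G {a, b} = (\<lambda>(j, i). b [^] j \<otimes> a [^] i) ` ({..<N} \<times> {..<N})"
    (is "_ = ?f ` ?I")
proof (intro equalityI subsetI)
  have S: "b [^] j \<otimes> a [^] i \<in> ?f ` ?I" for i j :: nat
  proof -
    have "b [^] j \<otimes> a [^] i = ?f (j mod N, i mod N)"
      using pow_cong_exponent[OF a N(1), of i "i mod N"] pow_cong_exponent[OF b N(2), of j "j mod N"]
      by (simp add: cong_def)
    then show ?thesis by (rule image_eqI) (use N(3) in simp)
  qed
  have inv: "inv x = x [^] (N - 1)" if "x \<in> carrier G" "x [^] N = \<one>" for x
    using that N(3) by (intro inv_equality) (simp_all flip: nat_pow_Suc)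
  have gens: "a \<in> ?f ` ?I" "b \<in> ?f ` ?I" "inv a \<in> ?f ` ?I" "inv b \<in> ?f ` ?I"
    using S[of 0 1] S[of 1 0] S[of 0 "N - 1"] S[of "N - 1" 0] a b inv[OF a N(1)] inv[OF b N(2)]
    by simp_all
  fix z assume "z \<in> generate G {a, b}"
  then show "z \<in> ?f ` ?I"
  proof induction
    case one
    then show ?case using S[of 0 0] by simp
  next
    case (incl h)
    then show ?case using gens by blast
  next
    case (inv h)
    then show ?case using gens by blast
  next
    case (eng y z)
    then obtain j i j' i' :: nat
      where yz: "y = b [^] j \<otimes> a [^] i" "z = b [^] j' \<otimes> a [^] i'" by auto
    have "y \<otimes> z = b [^] j \<otimes> (a [^] i \<otimes> b [^] j') \<otimes> a [^] i'"
      using a b by (simp add: yz m_assoc)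
    also have "\<dots> = (b [^] j \<otimes> b [^] j') \<otimes> (a [^] (i * r ^ j') \<otimes> a [^] i')"
      using a b by (simp add: pow_commute_twist[OF a b ab] m_assoc)
    also have "\<dots> = b [^] (j + j') \<otimes> a [^] (i * r ^ j' + i')"
      using a b by (simp add: nat_pow_mult)
    finally show ?case using S by metis
  qed
next
  fix z assume "z \<in> ?f ` ?I"
  then obtain j i :: nat where "z = b [^] j \<otimes> a [^] i" by auto
  moreover have "x [^] (i::nat) \<in> generate G {a, b}" if "x \<in> {a, b}" for x i
    using that by (induction i) (auto intro: generate.one generate.eng generate.incl)
  ultimately show "z \<in> generate G {a, b}" by (auto intro: generate.eng)
qed

end

section \<open>Subgroups of the semidirect product and partial difference sets\<close>

lemma mult_auto_semidirect [simp]: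
  "(\<alpha>, g) \<otimes>\<^bsub>auto_semidirect G f\<^esub> (\<beta>, h) = (\<beta> \<otimes>\<^bsub>AutoGroup G\<^esub> \<alpha>, \<beta> g \<otimes>\<^bsub>G\<^esub> h)"
  and one_auto_semidirect [simp]: "\<one>\<^bsub>auto_semidirect G f\<^esub> = (\<one>\<^bsub>AutoGroup G\<^esub>, \<one>\<^bsub>G\<^esub>)"
  and carrier_auto_semidirect:
    "carrier (auto_semidirect G f) = generate (AutoGroup G) {f} \<times> carrier G"
  by (simp_all add: auto_semidirect_def)

context group
begin

lemma carrier_AutoGroup: "carrier (AutoGroup G) = auto G"
  by (simp add: AutoGroup_def)

lemma one_AutoGroup_apply: "g \<in> carrier G \<Longrightarrow> \<one>\<^bsub>AutoGroup G\<^esub> g = g"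
  by (simp add: AutoGroup_def BijGroup_def)

lemma mult_AutoGroup_apply:
  "\<alpha> \<in> auto G \<Longrightarrow> \<beta> \<in> auto G \<Longrightarrow> g \<in> carrier G \<Longrightarrow> (\<beta> \<otimes>\<^bsub>AutoGroup G\<^esub> \<alpha>) g = \<beta> (\<alpha> g)"
  by (simp add: AutoGroup_def BijGroup_def auto_def compose_eq)

lemma auto_closed: "\<alpha> \<in> auto G \<Longrightarrow> g \<in> carrier G \<Longrightarrow> \<alpha> g \<in> carrier G"
  and auto_mult: "\<alpha> \<in> auto G \<Longrightarrow> g \<in> carrier G \<Longrightarrow> h \<in> carrier G \<Longrightarrow> \<alpha> (g \<otimes> h) = \<alpha> g \<otimes> \<alpha> h"
  by (auto simp: auto_def hom_def)

lemma auto_one: "\<alpha> \<in> auto G \<Longrightarrow> \<alpha> \<one> = \<one>"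
  using hom_one[OF _ is_group is_group] by (auto simp: auto_def)

lemma group_auto_semidirect:
  assumes f: "f \<in> auto G"
  shows "group (auto_semidirect G f)"
proof (rule groupI)
  interpret A: group "AutoGroup G" by (rule AutoGroup)
  let ?F = "generate (AutoGroup G) {f}"
  have sub: "subgroup ?F (AutoGroup G)"
    using f by (intro A.generate_is_subgroup) (simp add: carrier_AutoGroup)
  note F = subgroup.mem_carrier[OF sub, unfolded carrier_AutoGroup]
  show "\<And>x y. x \<in> carrier (auto_semidirect G f) \<Longrightarrow> y \<in> carrier (auto_semidirect G f) \<Longrightarrow>
      x \<otimes>\<^bsub>auto_semidirect G f\<^esub> y \<in> carrier (auto_semidirect G f)"
    using F by (auto simp: carrier_auto_semidirect auto_closed intro: subgroup.m_closed[OF sub])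
  show "\<one>\<^bsub>auto_semidirect G f\<^esub> \<in> carrier (auto_semidirect G f)"
    by (simp add: carrier_auto_semidirect generate.one)
  show "\<And>x y z. x \<in> carrier (auto_semidirect G f) \<Longrightarrow> y \<in> carrier (auto_semidirect G f) \<Longrightarrow>
      z \<in> carrier (auto_semidirect G f) \<Longrightarrow>
      (x \<otimes>\<^bsub>auto_semidirect G f\<^esub> y) \<otimes>\<^bsub>auto_semidirect G f\<^esub> z =
      x \<otimes>\<^bsub>auto_semidirect G f\<^esub> (y \<otimes>\<^bsub>auto_semidirect G f\<^esub> z)"
    using F by (auto simp: carrier_auto_semidirect auto_closed auto_mult mult_AutoGroup_apply m_assoc
        A.m_assoc carrier_AutoGroup)
  show "\<And>x. x \<in> carrier (auto_semidirect G f) \<Longrightarrow> \<one>\<^bsub>auto_semidirect G f\<^esub> \<otimes>\<^bsub>auto_semidirect G f\<^esub> x = x"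
    using F A.r_one by (auto simp: carrier_auto_semidirect auto_one carrier_AutoGroup)
  fix x assume "x \<in> carrier (auto_semidirect G f)"
  then obtain \<alpha> g where x: "x = (\<alpha>, g)" "\<alpha> \<in> ?F" "g \<in> carrier G"
    by (auto simp: carrier_auto_semidirect)
  define \<beta> where "\<beta> = inv\<^bsub>AutoGroup G\<^esub> \<alpha>"
  have \<beta>: "\<beta> \<in> ?F" using subgroup.m_inv_closed[OF sub x(2)] by (simp add: \<beta>_def)
  have \<alpha>: "\<alpha> \<in> auto G" using F x by simp
  have "\<alpha> (\<beta> (inv g)) = inv g"
    using mult_AutoGroup_apply[OF F[OF \<beta>] \<alpha>, of "inv g"] A.r_inv[of \<alpha>] \<alpha> x
    by (simp add: \<beta>_def carrier_AutoGroup one_AutoGroup_apply)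
  then have "(\<beta>, \<beta> (inv g)) \<otimes>\<^bsub>auto_semidirect G f\<^esub> x = \<one>\<^bsub>auto_semidirect G f\<^esub>"
    using x \<alpha> A.r_inv[of \<alpha>] by (simp add: \<beta>_def carrier_AutoGroup)
  then show "\<exists>y\<in>carrier (auto_semidirect G f). y \<otimes>\<^bsub>auto_semidirect G f\<^esub> x = \<one>\<^bsub>auto_semidirect G f\<^esub>"
    using \<beta> F x by (auto simp: carrier_auto_semidirect auto_closed)
qed

end

text \<open>
  Let \<open>K\<close> be the subgroup. If \<open>w e = z\<close> in \<open>K\<close>, then \<open>\<beta> (snd w) = snd z (snd e)\<^sup>-\<^sup>1\<close>, where \<open>\<beta>\<close> is
  the first component of \<open>e\<close>. As \<open>\<beta>\<close> preserves \<open>D\<close>, the quotient \<open>w\<close> of \<open>z\<close> by \<open>e\<close> projects into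
  \<open>D\<close> exactly if the quotient of the projections lies in \<open>D\<close>. So \<open>snd\<close> preserves the counts that
  define a partial difference set, although it need not be a homomorphism.
\<close>

lemma (in group) regular_pds_transfer:
  assumes f: "f \<in> auto G" and pds: "regular_partial_difference_set G v k l m D"
    and fD: "\<And>g. g \<in> carrier G \<Longrightarrow> f g \<in> D \<longleftrightarrow> g \<in> D"
    and bij: "bij_betw snd (carrier (subgroup_generated (auto_semidirect G f) A)) (carrier G)"
  shows "\<exists>D'. regular_partial_difference_set (subgroup_generated (auto_semidirect G f) A) v k l m D'"
proof -
  interpret A: group "AutoGroup G" by (rule AutoGroup)
  interpret S: group "auto_semidirect G f" by (rule group_auto_semidirect[OF f])
  let ?K = "subgroup_generated (auto_semidirect G f) A"
  interpret K: group ?K by (rule S.group_subgroup_generated)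
  note [simp del] = mult_subgroup_generated one_subgroup_generated S.inv_subgroup_generated
  have fcar: "{f} \<subseteq> carrier (AutoGroup G)" using f by (simp add: carrier_AutoGroup)
  have inv: "\<forall>g\<in>carrier G. \<alpha> g \<in> D \<longleftrightarrow> g \<in> D" if "\<alpha> \<in> generate (AutoGroup G) {f}" for \<alpha>
    using that
  proof induction
    case one
    show ?case by (simp add: one_AutoGroup_apply)
  next
    case (incl h)
    then show ?case using fD by simp
  next
    case (inv h)
    let ?b = "inv\<^bsub>AutoGroup G\<^esub> f"
    have b: "?b \<in> auto G" using f A.inv_closed by (simp add: carrier_AutoGroup)
    have "?b g \<in> D \<longleftrightarrow> g \<in> D" if "g \<in> carrier G" for g
    proof -
      have "f (?b g) = g"
        using mult_AutoGroup_apply[OF b f that] A.r_inv[of f] f that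
        by (simp add: carrier_AutoGroup one_AutoGroup_apply)
      then show ?thesis using fD[OF auto_closed[OF b that]] by simp
    qed
    then show ?case using inv by simp
  next
    case (eng \<beta> \<alpha>)
    then have "\<beta> \<in> auto G" "\<alpha> \<in> auto G"
      using A.generate_in_carrier[OF fcar] by (simp_all add: carrier_AutoGroup)
    then show ?case using eng.IH by (simp add: mult_AutoGroup_apply auto_closed)
  qed
  have Dsub: "D \<subseteq> carrier G" and D1: "\<one> \<notin> D" and Dinv: "D = m_inv G ` D"
    and fin: "finite (carrier G)" and card: "card (carrier G) = v" "card D = k"
    and l: "\<And>g. g \<in> D - {\<one>} \<Longrightarrow> card {(c, d) \<in> D \<times> D. g = c \<otimes> inv d} = l"
    and m: "\<And>g. g \<in> carrier G - (D \<union> {\<one>}) \<Longrightarrow> card {(c, d) \<in> D \<times> D. g = c \<otimes> inv d} = m"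
    using pds unfolding regular_partial_difference_set_def partial_difference_set_def by blast+
  define D' where "D' = {z \<in> carrier ?K. snd z \<in> D}"
  have Kcar: "fst z \<in> generate (AutoGroup G) {f}" "snd z \<in> carrier G" if "z \<in> carrier ?K" for z
    using that S.carrier_subgroup_generated_subset[of A]
    by (cases z; auto simp: carrier_auto_semidirect)+
  have snd_mult: "snd (z \<otimes>\<^bsub>?K\<^esub> e) = fst e (snd z) \<otimes> snd e" for z e
    by (cases z; cases e) (simp add: subgroup_generated_def)
  have quot: "snd (z \<otimes>\<^bsub>?K\<^esub> inv\<^bsub>?K\<^esub> e) \<in> D \<longleftrightarrow> snd z \<otimes> inv (snd e) \<in> D"
    if "z \<in> carrier ?K" "e \<in> carrier ?K" for z e
  proof -
    let ?w = "z \<otimes>\<^bsub>?K\<^esub> inv\<^bsub>?K\<^esub> e"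
    have w: "?w \<in> carrier ?K" using that by (intro K.m_closed K.inv_closed)
    have \<beta>: "fst e \<in> auto G"
      using A.generate_in_carrier[OF fcar] Kcar(1)[OF that(2)] by (simp add: carrier_AutoGroup)
    have "?w \<otimes>\<^bsub>?K\<^esub> e = z"
      using that by (simp only: K.m_assoc K.inv_closed K.l_inv K.r_one)
    then have "fst e (snd ?w) \<otimes> snd e = snd z" by (metis snd_mult)
    then have "fst e (snd ?w) = snd z \<otimes> inv (snd e)"
      using Kcar that w \<beta> by (subst inv_solve_right) (simp_all add: auto_closed)
    then show ?thesis using inv[OF Kcar(1)[OF that(2)]] Kcar(2)[OF w] by metis
  qed
  have inv_D: "inv g \<in> D" if "g \<in> D" for g using Dinv that by blast
  have inv_D': "inv\<^bsub>?K\<^esub> e \<in> D'" if "e \<in> D'" for e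
  proof -
    have e: "e \<in> carrier ?K" "snd e \<in> D" using that by (simp_all add: D'_def)
    have ie: "inv\<^bsub>?K\<^esub> e \<in> carrier ?K" using e(1) by (rule K.inv_closed)
    have "snd (\<one>\<^bsub>?K\<^esub> \<otimes>\<^bsub>?K\<^esub> inv\<^bsub>?K\<^esub> e) \<in> D"
      unfolding quot[OF K.one_closed e(1)] using inv_D[OF e(2)] Dsub by (auto simp: one_subgroup_generated)
    then have "snd (inv\<^bsub>?K\<^esub> e) \<in> D" unfolding K.l_one[OF ie] .
    then show ?thesis using ie unfolding D'_def by blast
  qed
  have D'sub: "D' \<subseteq> carrier ?K" by (auto simp: D'_def)
  have D'inv: "D' = m_inv ?K ` D'"
  proof (intro equalityI subsetI)
    fix e assume "e \<in> D'"
    moreover from this have "e = inv\<^bsub>?K\<^esub> (inv\<^bsub>?K\<^esub> e)" using D'sub K.inv_inv by (metis subsetD)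
    ultimately show "e \<in> m_inv ?K ` D'" using inv_D' by blast
  qed (use inv_D' in blast)
  have inj: "inj_on snd (carrier ?K)" and surj: "snd ` carrier ?K = carrier G"
    using bij by (auto simp: bij_betw_def)
  have card_pull: "card {z \<in> carrier ?K. P (snd z)} = card {g \<in> carrier G. P g}" for P
  proof -
    have "snd ` {z \<in> carrier ?K. P (snd z)} = {g \<in> carrier G. P g}"
      unfolding surj[symmetric] by auto
    then show ?thesis
      using card_image[OF inj_on_subset[OF inj], of "{z \<in> carrier ?K. P (snd z)}"] by auto
  qed
  have fibre: "card {(c, d) \<in> D' \<times> D'. z = c \<otimes>\<^bsub>?K\<^esub> inv\<^bsub>?K\<^esub> d} =
      card {(c, d) \<in> D \<times> D. snd z = c \<otimes> inv d}" if z: "z \<in> carrier ?K" for z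
  proof -
    have "{e \<in> D'. z \<otimes>\<^bsub>?K\<^esub> inv\<^bsub>?K\<^esub> e \<in> D'} =
        {e \<in> carrier ?K. snd e \<in> D \<and> snd z \<otimes> inv (snd e) \<in> D}"
      using quot[OF z] z by (force simp: D'_def)
    then have "card {e \<in> D'. z \<otimes>\<^bsub>?K\<^esub> inv\<^bsub>?K\<^esub> e \<in> D'} = card {e \<in> carrier G. e \<in> D \<and> snd z \<otimes> inv e \<in> D}"
      using card_pull[of "\<lambda>g. g \<in> D \<and> snd z \<otimes> inv g \<in> D"] by simp
    also have "{e \<in> carrier G. e \<in> D \<and> snd z \<otimes> inv e \<in> D} = {e \<in> D. snd z \<otimes> inv e \<in> D}"
      using Dsub by auto
    finally show ?thesis
      using K.card_quotients_eq[OF D'sub D'inv z] card_quotients_eq[OF Dsub Dinv Kcar(2)[OF z]]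
      by simp
  qed
  have snd_one: "snd \<one>\<^bsub>?K\<^esub> = \<one>" by (simp add: one_subgroup_generated)
  have "card D' = k"
  proof -
    have "card D' = card {g \<in> carrier G. g \<in> D}" unfolding D'_def by (rule card_pull[of "\<lambda>g. g \<in> D"])
    also have "{g \<in> carrier G. g \<in> D} = D" using Dsub by auto
    finally show ?thesis using card by simp
  qed
  moreover have "\<one>\<^bsub>?K\<^esub> \<notin> D'" using D1 by (simp add: D'_def snd_one)
  moreover have "finite (carrier ?K)" "card (carrier ?K) = v"
    using bij_betw_finite[OF bij] fin bij_betw_same_card[OF bij] card by simp_all
  moreover have "card {(c, d) \<in> D' \<times> D'. z = c \<otimes>\<^bsub>?K\<^esub> inv\<^bsub>?K\<^esub> d} = l"
    if "z \<in> D' - {\<one>\<^bsub>?K\<^esub>}" for z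
  proof -
    have "snd z \<in> D - {\<one>}" using that D1 by (auto simp: D'_def)
    then show ?thesis using fibre[of z] l[of "snd z"] that D'sub by auto
  qed
  moreover have "card {(c, d) \<in> D' \<times> D'. z = c \<otimes>\<^bsub>?K\<^esub> inv\<^bsub>?K\<^esub> d} = m"
    if "z \<in> carrier ?K - (D' \<union> {\<one>\<^bsub>?K\<^esub>})" for z
  proof -
    have "snd z \<noteq> snd \<one>\<^bsub>?K\<^esub>" using that inj_onD[OF inj, of z "\<one>\<^bsub>?K\<^esub>"] K.one_closed by blast
    then have "snd z \<in> carrier G - (D \<union> {\<one>})"
      using that Kcar(2)[of z] unfolding snd_one by (auto simp: D'_def)
    then show ?thesis using fibre[of z] m[of "snd z"] that by auto
  qed
  ultimately have "regular_partial_difference_set ?K v k l m D'"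
    unfolding regular_partial_difference_set_def partial_difference_set_def
    using K.is_group D'sub D'inv by blast
  then show ?thesis ..
qed

section \<open>Geometric sums of the twist\<close>

context
  fixes p n :: nat
  assumes p: "Factorial_Ring.prime p" and n: "n \<ge> 2"
begin

lemma prime_power_step: "p * p ^ (n - 1) = p ^ n"
  using n by (cases n) auto

text \<open>
  The square of \<open>p ^ (n - 1)\<close> is divisible by \<open>p ^ n\<close>, so the binomial expansion stops after two
  terms.
\<close>

lemma twist_power_cong: "[(p ^ (n - 1) + 1) ^ i = 1 + i * p ^ (n - 1)] (mod p ^ n)"
proof (induction i)
  case (Suc i)
  let ?P = "p ^ (n - 1)"
  have "p ^ n dvd ?P * ?P" using n by (auto simp flip: power_add intro: le_imp_power_dvd)
  then have 0: "[i * (?P * ?P) = 0] (mod p ^ n)" by (simp add: cong_0_iff)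
  have "[(?P + 1) ^ Suc i = (?P + 1) * (1 + i * ?P)] (mod p ^ n)"
    unfolding power_Suc by (rule cong_scalar_left[OF Suc])
  also have "(?P + 1) * (1 + i * ?P) = (1 + Suc i * ?P) + i * (?P * ?P)"
    by (simp add: algebra_simps)
  also have "[\<dots> = 1 + Suc i * ?P + 0] (mod p ^ n)" by (rule cong_add[OF cong_refl 0])
  finally show ?case by simp
qed simp

text \<open>
  The exponent of \<open>y\<close> in the second component of \<open>(\<phi>, y) ^ j\<close>.
\<close>

definition geom :: "nat \<Rightarrow> nat"
  where "geom j = (\<Sum>i<j. (p ^ (n - 1) + 1) ^ i)"

lemma geom_cong: "[geom j = j + p ^ (n - 1) * (j choose 2)] (mod p ^ n)"
proof (induction j)
  case (Suc j)
  have "[geom j + (p ^ (n - 1) + 1) ^ j =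
      (j + p ^ (n - 1) * (j choose 2)) + (1 + j * p ^ (n - 1))] (mod p ^ n)"
    by (rule cong_add[OF Suc twist_power_cong])
  moreover have "Suc j choose 2 = j + (j choose 2)" by (simp add: numeral_2_eq_2)
  ultimately show ?case by (simp add: geom_def algebra_simps)
qed (simp add: geom_def numeral_2_eq_2)

text \<open>
  Twice the difference of the two binomial coefficients is \<open>(i - j) (i + j - 1)\<close>. For odd \<open>p\<close> the
  factor two can be cancelled; for \<open>p = 2\<close> it costs one factor of \<open>i - j\<close>, and
  \<open>p ^ (n - 1)\<close> is divisible by four because \<open>n \<ge> 3\<close>.
\<close>

lemma choose_two_cong:
  assumes "(p, n) \<noteq> (2, 2)" "[i = j] (mod p ^ (n - 1))"
  shows "[i choose 2 = j choose 2] (mod p)"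
proof -
  let ?c = "\<lambda>i. int (i choose 2)"
  have c: "2 * ?c i = int i * (int i - 1)" for i
    by (induction i) (simp_all add: numeral_2_eq_2 algebra_simps)
  have *: "2 * (?c i - ?c j) = (int i - int j) * (int i + int j - 1)"
    by (simp add: right_diff_distrib c algebra_simps)
  have ij: "int (p ^ (n - 1)) dvd int i - int j"
    using assms(2) by (simp add: cong_iff_dvd_diff flip: cong_int_iff)
  have "int p dvd ?c i - ?c j"
  proof (cases "p = 2")
    case True
    then have "2 \<le> n - 1" using n assms(1) by auto
    then have "2 ^ 2 dvd int (p ^ (n - 1))" using True le_imp_power_dvd[of 2 "n - 1" "2 :: int"] by simp
    then have "2 * 2 dvd 2 * (?c i - ?c j)"
      unfolding * using ij by (metis dvd_mult2 dvd_trans power2_eq_square)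
    then show ?thesis using True by (metis dvd_mult_cancel_left of_nat_numeral zero_neq_numeral)
  next
    case False
    have "int p dvd int (p ^ (n - 1))" using n by (auto intro: dvd_power)
    then have "int p dvd 2 * (?c i - ?c j)"
      unfolding * using ij by (metis dvd_mult2 dvd_trans)
    moreover have "\<not> int p dvd 2"
    proof
      assume "int p dvd 2"
      then have "p dvd 2" by (metis int_dvd_int_iff of_nat_numeral)
      then show False using False p primes_dvd_imp_eq two_is_prime_nat by blast
    qed
    moreover have "Factorial_Ring.prime (int p)" using p by simp
    ultimately show ?thesis using prime_dvd_mult_iff by blast
  qed
  then show ?thesis by (simp add: cong_iff_dvd_diff flip: cong_int_iff)
qed

text \<open>
  Both congruences imply the one modulo \<open>p ^ (n - 1)\<close>, and then \<open>geom i\<close> and \<open>geom j\<close> differ from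
  \<open>i\<close> and \<open>j\<close> by the same amount modulo \<open>p ^ n\<close>. For \<open>p = n = 2\<close> this fails, as
  \<open>geom 2 = 4\<close> is congruent to \<open>geom 0\<close>.
\<close>

lemma geom_cong_iff:
  assumes "(p, n) \<noteq> (2, 2)"
  shows "[geom i = geom j] (mod p ^ n) \<longleftrightarrow> [i = j] (mod p ^ n)"
proof -
  let ?P = "p ^ (n - 1)"
  have dvd: "?P dvd p ^ n" by (auto intro: le_imp_power_dvd)
  have low: "[geom j = j] (mod ?P)" for j
    using cong_dvd_modulus_nat[OF geom_cong dvd, of j] by (auto simp: cong_def)
  have *: "[geom i = geom j] (mod p ^ n) \<longleftrightarrow> [i = j] (mod p ^ n)" if ij: "[i = j] (mod ?P)"
  proof -
    have "[?P * (i choose 2) = ?P * (j choose 2)] (mod ?P * p)"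
      using cong_cmult_leftI[OF choose_two_cong[OF assms ij]] .
    then have P: "[?P * (i choose 2) = ?P * (j choose 2)] (mod p ^ n)"
      by (simp add: mult.commute flip: prime_power_step)
    have "[geom i = geom j] (mod p ^ n) \<longleftrightarrow>
        [i + ?P * (i choose 2) = j + ?P * (j choose 2)] (mod p ^ n)"
      using geom_cong[of i] geom_cong[of j] unfolding cong_def by argo
    also have "\<dots> \<longleftrightarrow> [i + ?P * (i choose 2) = j + ?P * (i choose 2)] (mod p ^ n)"
      using cong_add[OF cong_refl[of j] P] unfolding cong_def by argo
    also have "\<dots> \<longleftrightarrow> [i = j] (mod p ^ n)" by (rule cong_add_rcancel_nat)
    finally show ?thesis .
  qed
  show ?thesis
  proof
    assume "[geom i = geom j] (mod p ^ n)"
    moreover from this have "[i = j] (mod ?P)"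
      using cong_dvd_modulus_nat[OF _ dvd, of "geom i" "geom j"] low[of i] low[of j]
      unfolding cong_def by argo
    ultimately show "[i = j] (mod p ^ n)" using * by simp
  next
    assume "[i = j] (mod p ^ n)"
    then show "[geom i = geom j] (mod p ^ n)" using * cong_dvd_modulus_nat[OF _ dvd] by blast
  qed
qed

lemma geom_Suc: "geom (Suc j) = geom j * (p ^ (n - 1) + 1) + 1"
  unfolding geom_def sum.lessThan_Suc_shift sum_distrib_right
  by (simp add: mult.commute del: sum.lessThan_Suc mult_Suc mult_Suc_right)

end

section \<open>The two groups of the theorem\<close>

lemma nat_pow_DirProd:
  "(a, b) [^]\<^bsub>G \<times>\<times> H\<^esub> (i::nat) = (a [^]\<^bsub>G\<^esub> i, b [^]\<^bsub>H\<^esub> i)"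
  by (induction i) (simp_all add: nat_pow_def DirProd_def)

lemma mod_less_cong_eq: "[i = j] (mod N) \<Longrightarrow> i < N \<Longrightarrow> j < N \<Longrightarrow> i = (j::nat)"
  by (simp add: cong_def)

lemma UNIV_gen_xy: "UNIV = {Gen_x, Gen_y}"
  using gen_xy.exhaust by auto

lemma UNIV_gen_ab: "UNIV = {Gen_a, Gen_b}"
  using gen_ab.exhaust by auto

text \<open>
  Every element is of the form \<open>y\<^sup>j x\<^sup>i\<close>. The exponents are unique because the homomorphism into the
  product of two cyclic groups of order \<open>p ^ n\<close> with \<open>x \<mapsto> (1, 0)\<close> and \<open>y \<mapsto> (0, 1)\<close> reads them
  off.
\<close>

lemma G_xy_structure:
  assumes p: "Factorial_Ring.prime p" and n: "n \<ge> 2"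
  shows "comm_group (G_xy p n)"
    and "elt_x p n \<in> carrier (G_xy p n)" and "elt_y p n \<in> carrier (G_xy p n)"
    and "elt_x p n [^]\<^bsub>G_xy p n\<^esub> (p ^ n) = \<one>\<^bsub>G_xy p n\<^esub>"
    and "elt_y p n [^]\<^bsub>G_xy p n\<^esub> (p ^ n) = \<one>\<^bsub>G_xy p n\<^esub>"
    and "bij_betw (\<lambda>(j, i). elt_y p n [^]\<^bsub>G_xy p n\<^esub> j \<otimes>\<^bsub>G_xy p n\<^esub> elt_x p n [^]\<^bsub>G_xy p n\<^esub> i)
      ({..<p ^ n} \<times> {..<p ^ n}) (carrier (G_xy p n))"
proof -
  define N where "N = p ^ n"
  have N1: "1 < N" 
    using prime_gt_1_nat[OF p] n one_less_power[of p n] by (simp add: N_def)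
  let ?R = "xy_relations p n"
  let ?h = "\<lambda>g. word_class ?R [Pos g]"
  define G where "G = G_xy p n"
  have Gdef: "G = presented_group ?R" by (simp add: G_def G_xy_def)
  interpret G: group G unfolding Gdef by (rule group_presented_group)
  define x y where "x = elt_x p n" and "y = elt_y p n"
  have xh: "?h Gen_x = x" "?h Gen_y = y" by (simp_all add: x_def y_def elt_x_def elt_y_def)
  have hcar: "range ?h \<subseteq> carrier G" by (auto simp: Gdef carrier_presented_group)
  have x: "x \<in> carrier G" and y: "y \<in> carrier G" using hcar xh by auto
  note rel = presented_group_relation[of _ _ ?R, folded Gdef]
  have mem: "(replicate (p ^ n) (Pos Gen_x), []) \<in> ?R" "(replicate (p ^ n) (Pos Gen_y), []) \<in> ?R"
    "([Neg Gen_x, Neg Gen_y, Pos Gen_x, Pos Gen_y], []) \<in> ?R"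
    by (simp_all add: xy_relations_def)
  have pow: "x [^]\<^bsub>G\<^esub> N = \<one>\<^bsub>G\<^esub>" "y [^]\<^bsub>G\<^esub> N = \<one>\<^bsub>G\<^esub>"
    using rel[OF mem(1)] rel[OF mem(2)] by (simp_all add: G.word_value_replicate[OF hcar] xh N_def)
  have "inv\<^bsub>G\<^esub> x \<otimes>\<^bsub>G\<^esub> (inv\<^bsub>G\<^esub> y \<otimes>\<^bsub>G\<^esub> (x \<otimes>\<^bsub>G\<^esub> y)) = \<one>\<^bsub>G\<^esub>"
    using rel[OF mem(3)] x y by (simp add: xh)
  then have "y \<otimes>\<^bsub>G\<^esub> x = x \<otimes>\<^bsub>G\<^esub> y"
    using x y by (metis G.inv_closed G.inv_equality G.inv_inv G.inv_mult_group G.m_assoc G.m_closed)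
  then have xy: "x \<otimes>\<^bsub>G\<^esub> y = y \<otimes>\<^bsub>G\<^esub> x [^]\<^bsub>G\<^esub> (1::nat)" using x by simp
  let ?f = "\<lambda>(j, i). y [^]\<^bsub>G\<^esub> j \<otimes>\<^bsub>G\<^esub> x [^]\<^bsub>G\<^esub> i"
  have "range ?h = {x, y}" by (simp add: UNIV_gen_xy xh)
  then have car: "carrier G = ?f ` ({..<N} \<times> {..<N})"
    using presented_group_generated[of ?R] G.generate_twisted_pair[OF x y xy pow] N1
    by (simp add: Gdef)
  show "comm_group (G_xy p n)"
    unfolding G_def[symmetric]
  proof (rule G.group_comm_groupI)
    fix g h assume "g \<in> carrier G" "h \<in> carrier G"
    then obtain i j i' j' :: nat where "g = y [^]\<^bsub>G\<^esub> j \<otimes>\<^bsub>G\<^esub> x [^]\<^bsub>G\<^esub> i" "h = y [^]\<^bsub>G\<^esub> j' \<otimes>\<^bsub>G\<^esub> x [^]\<^bsub>G\<^esub> i'"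
      unfolding car by auto
    moreover have "y [^]\<^bsub>G\<^esub> j \<otimes>\<^bsub>G\<^esub> x [^]\<^bsub>G\<^esub> i \<otimes>\<^bsub>G\<^esub> (y [^]\<^bsub>G\<^esub> j' \<otimes>\<^bsub>G\<^esub> x [^]\<^bsub>G\<^esub> i') =
        y [^]\<^bsub>G\<^esub> (j + j') \<otimes>\<^bsub>G\<^esub> x [^]\<^bsub>G\<^esub> (i + i')" for j i j' i' :: nat
    proof -
      have "y [^]\<^bsub>G\<^esub> j \<otimes>\<^bsub>G\<^esub> x [^]\<^bsub>G\<^esub> i \<otimes>\<^bsub>G\<^esub> (y [^]\<^bsub>G\<^esub> j' \<otimes>\<^bsub>G\<^esub> x [^]\<^bsub>G\<^esub> i') =
          y [^]\<^bsub>G\<^esub> j \<otimes>\<^bsub>G\<^esub> (x [^]\<^bsub>G\<^esub> i \<otimes>\<^bsub>G\<^esub> y [^]\<^bsub>G\<^esub> j') \<otimes>\<^bsub>G\<^esub> x [^]\<^bsub>G\<^esub> i'"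
        using x y by (simp add: G.m_assoc)
      also have "\<dots> = (y [^]\<^bsub>G\<^esub> j \<otimes>\<^bsub>G\<^esub> y [^]\<^bsub>G\<^esub> j') \<otimes>\<^bsub>G\<^esub> (x [^]\<^bsub>G\<^esub> i \<otimes>\<^bsub>G\<^esub> x [^]\<^bsub>G\<^esub> i')"
        using x y G.pow_commute_twist[OF x y xy, of i j'] by (simp add: G.m_assoc)
      finally show ?thesis using x y by (simp add: G.nat_pow_mult)
    qed
    ultimately show "g \<otimes>\<^bsub>G\<^esub> h = h \<otimes>\<^bsub>G\<^esub> g" by (simp add: add.commute)
  qed
  \<comment> \<open>the homomorphism into the product of cyclic groups separates the elements\<close>
  have "inj_on ?f ({..<N} \<times> {..<N})"
  proof -
    let ?Z = "integer_mod_group N \<times>\<times> integer_mod_group N"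
    interpret Z: group ?Z by (intro DirProd_group) simp_all
    let ?k = "\<lambda>g. case g of Gen_x \<Rightarrow> (1, 0) | Gen_y \<Rightarrow> (0, 1::int)"
    have k: "range ?k \<subseteq> carrier ?Z" using N1 by (auto split: gen_xy.splits)
    have inv: "inv\<^bsub>?Z\<^esub> (a, b) = ((- a) mod int N, (- b) mod int N)"
      if "a \<in> carrier (integer_mod_group N)" "b \<in> carrier (integer_mod_group N)" for a b
      using that by (simp add: inv_DirProd)
    have R: "word_value ?Z ?k u = word_value ?Z ?k v" if "(u, v) \<in> ?R" for u v
    proof -
      have "word_value ?Z ?k [Neg Gen_x, Neg Gen_y, Pos Gen_x, Pos Gen_y] = \<one>\<^bsub>?Z\<^esub>"
        using N1 by (simp add: inv mod_simps)
      moreover have "word_value ?Z ?k (replicate N (Pos g)) = \<one>\<^bsub>?Z\<^esub>" for g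
        unfolding Z.word_value_replicate[OF k] by (cases g) (simp_all add: nat_pow_DirProd)
      ultimately show ?thesis
        using that unfolding xy_relations_def N_def[symmetric] by auto
    qed
    have "\<exists>\<psi>\<in>hom G ?Z. (\<forall>w. \<psi> (word_class ?R w) = word_value ?Z ?k w) \<and>
        \<psi> ` carrier G = generate ?Z (range ?k)"
      unfolding Gdef by (rule Z.presented_group_universal[OF k R])
    then obtain \<psi> where \<psi>: "\<psi> \<in> hom G ?Z" "\<And>w. \<psi> (word_class ?R w) = word_value ?Z ?k w"
      by blast
    interpret \<psi>: group_hom G ?Z \<psi> by unfold_locales (rule \<psi>(1))
    have "\<psi> x = (1, 0)" "\<psi> y = (0, 1)"
      using \<psi>(2)[of "[Pos Gen_x]"] \<psi>(2)[of "[Pos Gen_y]"] N1 by (simp_all add: xh)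
    then have "\<psi> (y [^]\<^bsub>G\<^esub> j \<otimes>\<^bsub>G\<^esub> x [^]\<^bsub>G\<^esub> i) = (int i mod int N, int j mod int N)" for i j :: nat
      using x y by (simp add: \<psi>.hom_nat_pow nat_pow_DirProd)
    then have "\<psi> (?f (j, i)) = (int i, int j)" if "i < N" "j < N" for i j
      using that by simp
    then show ?thesis
      by (intro inj_on_inverseI[of _ "\<lambda>g. (nat (snd (\<psi> g)), nat (fst (\<psi> g)))"]) auto
  qed
  then show "bij_betw (\<lambda>(j, i). elt_y p n [^]\<^bsub>G_xy p n\<^esub> j \<otimes>\<^bsub>G_xy p n\<^esub> elt_x p n [^]\<^bsub>G_xy p n\<^esub> i)
      ({..<p ^ n} \<times> {..<p ^ n}) (carrier (G_xy p n))"
    using car unfolding bij_betw_def N_def G_def x_def y_def by simp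
  show "elt_x p n \<in> carrier (G_xy p n)" "elt_y p n \<in> carrier (G_xy p n)"
    "elt_x p n [^]\<^bsub>G_xy p n\<^esub> (p ^ n) = \<one>\<^bsub>G_xy p n\<^esub>" "elt_y p n [^]\<^bsub>G_xy p n\<^esub> (p ^ n) = \<one>\<^bsub>G_xy p n\<^esub>"
    using x y pow unfolding N_def G_def x_def y_def by simp_all
qed

context comm_group
begin

lemma power_auto:
  assumes "finite (carrier G)" "coprime r (order G)"
  shows "(\<lambda>g\<in>carrier G. g [^] (r::nat)) \<in> auto G" (is "?f \<in> _")
proof -
  have "inj_on ?f (carrier G)"
    using pow_coprime_order_inj[OF assms(2)] by (auto simp: inj_on_def)
  moreover have "?f ` carrier G \<subseteq> carrier G" by auto
  ultimately have "bij_betw ?f (carrier G) (carrier G)"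
    using endo_inj_surj[OF assms(1)] by (auto simp: bij_betw_def)
  then show ?thesis
    unfolding auto_def Bij_def by (auto simp: hom_def nat_pow_distrib)
qed

lemma power_auto_pow_apply:
  assumes f: "(\<lambda>g\<in>carrier G. g [^] (r::nat)) \<in> auto G" (is "?f \<in> _") and g: "g \<in> carrier G"
  shows "(?f [^]\<^bsub>AutoGroup G\<^esub> (k::nat)) g = g [^] (r ^ k)"
  using g
proof (induction k arbitrary: g)
  case 0
  then show ?case by (simp add: one_AutoGroup_apply)
next
  case (Suc k)
  interpret A: group "AutoGroup G" by (rule AutoGroup)
  have "?f [^]\<^bsub>AutoGroup G\<^esub> k \<in> auto G"
    using A.nat_pow_closed[of ?f k] f by (simp add: carrier_AutoGroup)
  then have "(?f [^]\<^bsub>AutoGroup G\<^esub> Suc k) g = (?f [^]\<^bsub>AutoGroup G\<^esub> k) (?f g)"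
    using mult_AutoGroup_apply[OF f _ Suc.prems] by simp
  also have "?f g = g [^] r" using Suc.prems by simp
  also have "(?f [^]\<^bsub>AutoGroup G\<^esub> k) (g [^] r) = g [^] (r ^ Suc k)"
    unfolding Suc.IH[OF nat_pow_closed[OF Suc.prems]] using Suc.prems by (simp add: nat_pow_pow)
  finally show ?case .
qed

end

theorem theorem4p2:
  fixes p n v k l m :: nat and D :: "gen_xy word set set"
  assumes "Factorial_Ring.prime p" and "n \<ge> 2" and "(p, n) \<noteq> (2, 2)"
    and "regular_partial_difference_set (G_xy p n) v k l m D"
  shows "group (calG p n) \<and> \<not> comm_group (calG p n) \<and>
    calG p n \<cong> twisted_group p n \<and>
    (\<exists>D'. regular_partial_difference_set (calG p n) v k l m D')"
proof -
  note p = assms(1) and n = assms(2) and pn = assms(3) and pds = assms(4)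
  define N P where "N = p ^ n" and "P = p ^ (n - 1)"
  have p2: "2 \<le> p" using prime_ge_2_nat[OF p] .
  have PN: "p * P = N" unfolding N_def P_def by (rule prime_power_step[OF p n])
  have "P > 1" using p2 n unfolding P_def by (intro one_less_power) auto
  then have PN_less: "1 < N" "P + 1 < N" using PN mult_le_mono1[OF p2, of P] by linarith+
  define G where "G = G_xy p n"
  define x y where "x = elt_x p n" and "y = elt_y p n"
  note struct = G_xy_structure[OF p n, folded G_def x_def y_def N_def]
  interpret G: comm_group G by (rule struct(1))
  note x = struct(2) and y = struct(3) and bij = struct(6)
  let ?I = "{..<N} \<times> {..<N}"
  let ?m = "\<lambda>(j, i). y [^]\<^bsub>G\<^esub> j \<otimes>\<^bsub>G\<^esub> x [^]\<^bsub>G\<^esub> i"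
  have fin: "finite (carrier G)" using bij_betw_finite[OF bij] by simp
  have ord: "order G = N * N" using bij_betw_same_card[OF bij] by (simp add: order_def)
  have expN: "g [^]\<^bsub>G\<^esub> N = \<one>\<^bsub>G\<^esub>" if g: "g \<in> carrier G" for g
  proof -
    obtain j i :: nat where "g = y [^]\<^bsub>G\<^esub> j \<otimes>\<^bsub>G\<^esub> x [^]\<^bsub>G\<^esub> i"
      using g unfolding bij_betw_imp_surj_on[OF bij, symmetric] by auto
    moreover have "(z [^]\<^bsub>G\<^esub> i) [^]\<^bsub>G\<^esub> N = (z [^]\<^bsub>G\<^esub> N) [^]\<^bsub>G\<^esub> i" if "z \<in> carrier G" for z and i :: nat
      using that by (simp add: G.nat_pow_pow mult.commute)
    ultimately show ?thesis using x y struct(4,5) by (simp add: G.nat_pow_distrib)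
  qed
  define r where "r = P + 1"
  have r_pow: "[r ^ i = 1 + i * P] (mod N)" for i
    unfolding r_def N_def P_def by (rule twist_power_cong[OF p n])
  have cop: "coprime r (order G)"
  proof -
    have "coprime r p"
    proof -
      have "p dvd P" using n unfolding P_def by (auto intro: dvd_power)
      then show ?thesis unfolding r_def
        by (metis coprime_add_one_left coprime_commute coprime_divisors dvd_refl)
    qed
    then show ?thesis by (simp add: ord N_def)
  qed
  have "[1 + p * P = 1 + 0] (mod N)" unfolding PN by (intro cong_add cong_refl) (simp add: cong_0_iff)
  then have rp: "[r ^ p = 1] (mod N)" using cong_trans[OF r_pow[of p]] by simp
  have "[1 + N * P = 1 + 0] (mod N)" by (intro cong_add cong_refl) (simp add: cong_0_iff)
  then have rN: "[r ^ N = 1] (mod N)" using cong_trans[OF r_pow[of N]] by simp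
  define f where "f = phi p n"
  have f: "f = (\<lambda>g\<in>carrier G. g [^]\<^bsub>G\<^esub> r)" by (simp add: f_def phi_def G_def r_def P_def)
  have f_auto: "f \<in> auto G" unfolding f by (rule G.power_auto[OF fin cop])
  interpret A: group "AutoGroup G" by (rule G.AutoGroup)
  have fA: "f \<in> carrier (AutoGroup G)" using f_auto by (simp add: G.carrier_AutoGroup)
  let ?S = "auto_semidirect G f"
  interpret S: group ?S by (rule G.group_auto_semidirect[OF f_auto])
  have f_pow: "(f [^]\<^bsub>AutoGroup G\<^esub> j) g = g [^]\<^bsub>G\<^esub> (r ^ j)" if "g \<in> carrier G" for g and j :: nat
    using G.power_auto_pow_apply[OF f_auto[unfolded f] that] unfolding f .
  have f_powN: "f [^]\<^bsub>AutoGroup G\<^esub> N = \<one>\<^bsub>AutoGroup G\<^esub>"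
  proof (rule extensionalityI[of _ "carrier G"])
    show "f [^]\<^bsub>AutoGroup G\<^esub> N \<in> extensional (carrier G)" "\<one>\<^bsub>AutoGroup G\<^esub> \<in> extensional (carrier G)"
      using A.nat_pow_closed[OF fA, of N] A.one_closed
      by (auto simp: G.carrier_AutoGroup auto_def Bij_def)
    fix g assume g: "g \<in> carrier G"
    then show "(f [^]\<^bsub>AutoGroup G\<^esub> N) g = \<one>\<^bsub>AutoGroup G\<^esub> g"
      using G.pow_cong_exponent[OF g expN[OF g] rN] by (simp add: f_pow G.one_AutoGroup_apply)
  qed
  define a b where "a = (\<one>\<^bsub>AutoGroup G\<^esub>, x)" and "b = (f, y)"
  have a: "a \<in> carrier ?S" and b: "b \<in> carrier ?S"
    using x y by (auto simp: a_def b_def carrier_auto_semidirect intro: generate.one generate.incl)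
  have a_pow: "a [^]\<^bsub>?S\<^esub> i = (\<one>\<^bsub>AutoGroup G\<^esub>, x [^]\<^bsub>G\<^esub> i)" for i :: nat
    by (induction i) (use x in \<open>simp_all add: a_def G.one_AutoGroup_apply\<close>)
  \<comment> \<open>\<open>\<phi>\<close> raises to the power \<open>r\<close>, so each new factor \<open>(\<phi>, y)\<close> turns the exponent \<open>e\<close> of \<open>y\<close> into \<open>e r + 1\<close>\<close>
  have b_pow: "b [^]\<^bsub>?S\<^esub> j = (f [^]\<^bsub>AutoGroup G\<^esub> j, y [^]\<^bsub>G\<^esub> geom p n j)" for j :: nat
  proof (induction j)
    case 0
    show ?case by (simp add: geom_def[OF p n])
  next
    case (Suc j)
    have "b [^]\<^bsub>?S\<^esub> Suc j =
        (f \<otimes>\<^bsub>AutoGroup G\<^esub> f [^]\<^bsub>AutoGroup G\<^esub> j, f (y [^]\<^bsub>G\<^esub> geom p n j) \<otimes>\<^bsub>G\<^esub> y)"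
      using Suc by (simp add: b_def)
    also have "f \<otimes>\<^bsub>AutoGroup G\<^esub> f [^]\<^bsub>AutoGroup G\<^esub> j = f [^]\<^bsub>AutoGroup G\<^esub> Suc j"
      using A.nat_pow_Suc2[OF fA] by simp
    also have "f (y [^]\<^bsub>G\<^esub> geom p n j) \<otimes>\<^bsub>G\<^esub> y = y [^]\<^bsub>G\<^esub> Suc (geom p n j * r)"
      using y by (simp add: f G.nat_pow_pow)
    also have "Suc (geom p n j * r) = geom p n (Suc j)"
      unfolding geom_Suc[OF p n] r_def P_def by simp
    finally show ?case .
  qed
  have ba: "b [^]\<^bsub>?S\<^esub> j \<otimes>\<^bsub>?S\<^esub> a [^]\<^bsub>?S\<^esub> i =
      (f [^]\<^bsub>AutoGroup G\<^esub> j, y [^]\<^bsub>G\<^esub> geom p n j \<otimes>\<^bsub>G\<^esub> x [^]\<^bsub>G\<^esub> i)" for j i :: nat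
    using A.nat_pow_closed[OF fA, of j] y by (simp add: a_pow b_pow G.one_AutoGroup_apply)
  have ab: "a \<otimes>\<^bsub>?S\<^esub> b = b \<otimes>\<^bsub>?S\<^esub> a [^]\<^bsub>?S\<^esub> r"
    using x y fA by (simp add: a_pow) (simp add: a_def b_def f G.one_AutoGroup_apply G.m_comm)
  note y_cong = G.pow_cong_exponent[OF y struct(5)]
  have geom: "[geom p n i = geom p n j] (mod N) \<longleftrightarrow> [i = j] (mod N)" for i j
    unfolding N_def by (rule geom_cong_iff[OF p n pn])
  have aN: "a [^]\<^bsub>?S\<^esub> N = \<one>\<^bsub>?S\<^esub>" using struct(4) by (simp add: a_pow)
  have bN: "b [^]\<^bsub>?S\<^esub> N = \<one>\<^bsub>?S\<^esub>"
  proof -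
    have "[geom p n N = geom p n 0] (mod N)" unfolding geom by (simp add: cong_def)
    then show ?thesis using y_cong[of "geom p n N" 0] by (simp add: b_pow f_powN geom_def[OF p n])
  qed
  define K where "K = subgroup_generated ?S {a, b}"
  have calG: "calG p n = K" by (simp add: calG_def K_def G_def f_def a_def b_def x_def y_def)
  interpret K: group K unfolding K_def by (rule S.group_subgroup_generated)
  let ?t = "\<lambda>(j, i). b [^]\<^bsub>?S\<^esub> j \<otimes>\<^bsub>?S\<^esub> a [^]\<^bsub>?S\<^esub> i"
  have "carrier ?S \<inter> {a, b} = {a, b}" using a b by auto
  then have carK_gen: "carrier K = generate ?S {a, b}"
    unfolding K_def carrier_subgroup_generated by simp
  also have "\<dots> = ?t ` ?I"
    by (rule S.generate_twisted_pair[OF a b ab aN bN]) (use PN_less in simp)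
  finally have carK: "carrier K = ?t ` ?I" .
  \<comment> \<open>the second component alone determines both exponents\<close>
  have inj: "inj_on (snd \<circ> ?t) ?I"
  proof (rule inj_onI)
    fix u w assume u: "u \<in> ?I" and w: "w \<in> ?I" and eq: "(snd \<circ> ?t) u = (snd \<circ> ?t) w"
    obtain j i j' i' where uw: "u = (j, i)" "w = (j', i')" by (cases u; cases w)
    have red: "y [^]\<^bsub>G\<^esub> geom p n j \<otimes>\<^bsub>G\<^esub> x [^]\<^bsub>G\<^esub> i = ?m (geom p n j mod N, i)" for j i
      using y_cong[of "geom p n j" "geom p n j mod N"] by (simp add: cong_def)
    have "?m (geom p n j mod N, i) = ?m (geom p n j' mod N, i')"
      using eq unfolding uw by (simp only: o_def case_prod_conv ba snd_conv red)
    then have "(geom p n j mod N, i) = (geom p n j' mod N, i')"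
      using u w PN_less unfolding uw
      by (intro inj_onD[OF bij_betw_imp_inj_on[OF bij]]) auto
    then have "[j = j'] (mod N)" "i = i'" using geom[of j j'] by (simp_all add: cong_def)
    then show "u = w" using u w mod_less_cong_eq[of j j' N] unfolding uw by simp
  qed
  have snd_bij: "bij_betw snd (carrier K) (carrier G)"
  proof -
    have sub: "snd ` carrier K \<subseteq> carrier G" unfolding carK using x y by (auto simp: ba)
    have "inj_on snd (carrier K)" using inj_on_imageI[OF inj] unfolding carK .
    moreover have "card (snd ` carrier K) = card (carrier G)"
      using card_image[OF inj] ord unfolding carK image_comp order_def by simp
    then have "snd ` carrier K = carrier G" by (rule card_subset_eq[OF fin sub])
    ultimately show ?thesis by (simp add: bij_betw_def)
  qed
  have cardK: "card (carrier K) = N * N"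
    using bij_betw_same_card[OF snd_bij] ord by (simp add: order_def)

  \<comment> \<open>if \<open>a\<close> and \<open>b\<close> commute, then \<open>b a\<^sup>r = b a\<close>, but \<open>1 < r < N\<close>\<close>
  have nonabelian: "\<not> comm_group K"
  proof
    assume "comm_group K"
    moreover have "a \<in> carrier K" "b \<in> carrier K"
      unfolding carK_gen by (auto intro: generate.incl)
    ultimately have "a \<otimes>\<^bsub>?S\<^esub> b = b \<otimes>\<^bsub>?S\<^esub> a"
      using comm_groupE(4)[of K a b] by (simp add: K_def)
    then have "b [^]\<^bsub>?S\<^esub> (1::nat) \<otimes>\<^bsub>?S\<^esub> a [^]\<^bsub>?S\<^esub> r = b [^]\<^bsub>?S\<^esub> (1::nat) \<otimes>\<^bsub>?S\<^esub> a [^]\<^bsub>?S\<^esub> (1::nat)"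
      unfolding S.nat_pow_eone[OF a] S.nat_pow_eone[OF b] using ab by simp
    then have "(snd \<circ> ?t) (1::nat, r) = (snd \<circ> ?t) (1::nat, 1::nat)"
      by (simp only: o_def case_prod_conv)
    then have "(1::nat, r) = (1, 1)"
      using PN_less by (intro inj_onD[OF inj]) (auto simp: r_def)
    then show False using \<open>P > 1\<close> by (simp add: r_def)
  qed

  \<comment> \<open>the presented group has at most \<open>N\<^sup>2\<close> elements and maps onto \<open>K\<close>, which has \<open>N\<^sup>2\<close>\<close>
  have iso: "K \<cong> twisted_group p n"
  proof -
    let ?R = "{(replicate (p ^ n) (Pos Gen_a), []), (replicate (p ^ n) (Pos Gen_b), []),
      ([Neg Gen_b, Pos Gen_a, Pos Gen_b], replicate (p ^ (n - 1) + 1) (Pos Gen_a))}"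
    define T where "T = presented_group ?R"
    have T: "twisted_group p n = T" by (simp add: twisted_group_def T_def)
    interpret T: group T unfolding T_def by (rule group_presented_group)
    let ?c = "\<lambda>g. word_class ?R [Pos g]"
    have c: "range ?c \<subseteq> carrier T" by (auto simp: T_def carrier_presented_group)
    note rel = presented_group_relation[of _ _ ?R, folded T_def]
    define a' b' where "a' = ?c Gen_a" and "b' = ?c Gen_b"
    have a': "a' \<in> carrier T" and b': "b' \<in> carrier T" using c by (auto simp: a'_def b'_def)
    have pow: "a' [^]\<^bsub>T\<^esub> N = \<one>\<^bsub>T\<^esub>" "b' [^]\<^bsub>T\<^esub> N = \<one>\<^bsub>T\<^esub>"
      using rel[of "replicate (p ^ n) (Pos Gen_a)" "[]"] rel[of "replicate (p ^ n) (Pos Gen_b)" "[]"]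
        T.word_value_replicate[OF c]
      by (simp_all add: N_def a'_def b'_def)
    have "inv\<^bsub>T\<^esub> b' \<otimes>\<^bsub>T\<^esub> (a' \<otimes>\<^bsub>T\<^esub> b') = a' [^]\<^bsub>T\<^esub> r"
      using rel[of "[Neg Gen_b, Pos Gen_a, Pos Gen_b]" "replicate (p ^ (n - 1) + 1) (Pos Gen_a)"]
        T.word_value_replicate[OF c, of "p ^ (n - 1) + 1" Gen_a] b'
      unfolding a'_def b'_def r_def P_def by simp
    then have ab': "a' \<otimes>\<^bsub>T\<^esub> b' = b' \<otimes>\<^bsub>T\<^esub> a' [^]\<^bsub>T\<^esub> r"
      using a' b' by (metis T.inv_solve_left T.m_closed T.nat_pow_closed)
    have "range ?c = {a', b'}" unfolding UNIV_gen_ab a'_def b'_def by simp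
    then have carT: "carrier T = (\<lambda>(j, i). b' [^]\<^bsub>T\<^esub> j \<otimes>\<^bsub>T\<^esub> a' [^]\<^bsub>T\<^esub> i) ` ?I"
      using presented_group_generated[of ?R] T.generate_twisted_pair[OF a' b' ab' pow] PN_less
      unfolding T_def by simp
    then have finT: "finite (carrier T)" and cardT: "card (carrier T) \<le> N * N"
      using card_image_le[of ?I "\<lambda>(j, i). b' [^]\<^bsub>T\<^esub> j \<otimes>\<^bsub>T\<^esub> a' [^]\<^bsub>T\<^esub> i"] by simp_all
    let ?d = "\<lambda>g. case g of Gen_a \<Rightarrow> a | Gen_b \<Rightarrow> b"
    have d: "range ?d \<subseteq> carrier ?S" using a b by (auto split: gen_ab.splits)
    have d_rng: "range ?d = {a, b}" unfolding UNIV_gen_ab by simp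
    have R: "word_value ?S ?d u = word_value ?S ?d w" if "(u, w) \<in> ?R" for u w
    proof -
      have "inv\<^bsub>?S\<^esub> b \<otimes>\<^bsub>?S\<^esub> (a \<otimes>\<^bsub>?S\<^esub> b) = a [^]\<^bsub>?S\<^esub> r"
        using a b ab by (metis S.inv_solve_left S.m_closed S.nat_pow_closed)
      then have "word_value ?S ?d [Neg Gen_b, Pos Gen_a, Pos Gen_b] =
          word_value ?S ?d (replicate r (Pos Gen_a))"
        using b by (simp add: S.word_value_replicate[OF d] del: one_auto_semidirect)
      moreover have "word_value ?S ?d (replicate N (Pos Gen_a)) = \<one>\<^bsub>?S\<^esub>"
        "word_value ?S ?d (replicate N (Pos Gen_b)) = \<one>\<^bsub>?S\<^esub>"
        using aN bN by (simp_all add: S.word_value_replicate[OF d])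
      ultimately show ?thesis
        using that unfolding N_def[symmetric] P_def[symmetric] r_def[symmetric] by auto
    qed
    have "\<exists>\<psi>\<in>hom T ?S. (\<forall>w. \<psi> (word_class ?R w) = word_value ?S ?d w) \<and>
        \<psi> ` carrier T = generate ?S (range ?d)"
      unfolding T_def by (rule S.presented_group_universal[OF d R])
    then obtain \<psi> where \<psi>: "\<psi> \<in> hom T ?S" "\<psi> ` carrier T = generate ?S (range ?d)"
      by blast
    have img: "\<psi> ` carrier T = carrier K" using \<psi>(2) unfolding d_rng carK_gen .
    then have "inj_on \<psi> (carrier T)"
      using cardK cardT card_image_le[OF finT, of \<psi>] by (intro eq_card_imp_inj_on[OF finT]) simp
    moreover have "\<psi> \<in> hom T K"
      using \<psi>(1) img unfolding hom_def K_def by auto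
    ultimately have "\<psi> \<in> iso T K" using img by (simp add: iso_iff)
    then have "T \<cong> K" by (rule is_isoI)
    then show ?thesis unfolding T by (rule T.iso_sym)
  qed

  interpret R: abelian_regular_pds G v k l m D
    by unfold_locales (use pds in \<open>simp add: G_def\<close>)
  have "even (order G) \<or> (\<exists>j. odd j \<and> (\<forall>g\<in>carrier G. g [^]\<^bsub>G\<^esub> (r ^ j) = g))"
  proof (cases "p = 2")
    case True
    then show ?thesis using n by (simp add: ord N_def)
  next
    case False
    then have "odd p" using p primes_dvd_imp_eq two_is_prime_nat by blast
    moreover have "g [^]\<^bsub>G\<^esub> (r ^ p) = g" if "g \<in> carrier G" for g
      using G.pow_cong_exponent[OF that expN[OF that] rp] that by simp
    ultimately show ?thesis by blast
  qed
  then have "f g \<in> D \<longleftrightarrow> g \<in> D" if "g \<in> carrier G" for g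
    using R.multiplier[OF cop _ that] that by (simp add: f)
  then have "\<exists>D'. regular_partial_difference_set K v k l m D'"
    unfolding K_def using pds snd_bij
    by (intro G.regular_pds_transfer[OF f_auto, of v k l m D]) (simp_all add: G_def K_def)
  then show ?thesis
    unfolding calG using K.is_group nonabelian iso by blast
qed

end
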